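(* There is an algorithm that solves Balanced Vertex in ${\cal O}(n)$ time on instances $(G,\pi,S)$ where $G$ is a cycle with $n$ vertices.
   Context: All graphs are finite, simple, connected, with unit-length edges; $d(u,v)$ is the shortest-path distance. A proper vertex list is a list $S=(s_1,\ldots,s_p)$ of pairwise different vertices; $d(v,S)=\min_i d(v,s_i)$. The (prioritized) Voronoi diagram of $G=(V,E)$ with respect to $S$ is the partition of $V$ into territories $\mathbb{T}(s_1,S),\ldots,\mathbb{T}(s_p,S)$ where $v\in\mathbb{T}(s_i,S)$ if and only if $d(v,s_i)=d(v,S)$ and $d(v,s_j)>d(v,S)$ for every $j$ with $1\le j<i$. For a cost function $\pi:V\to\mathbb{R}_{\ge 0}$, the load of $s_i$ is $\ell_\pi(s_i,S)=\sum_{v\in\mathbb{T}(s_i,S)}\pi(v)$, and $L_\pi(S)=\max_i \ell_\pi(s_i,S)$. For $v\in V\setminus S$, $S+v=(s_1,\ldots,s_p,v)$. Balanced Vertex: given a graph $G=(V,E)$, a cost function $\pi:V\to\mathbb{R}_{\ge 0}$ and a proper vertex list $S$, output a vertex $v\in V\setminus S$ such that $L_\pi(S+v)$ is minimized. Running times are worst-case, in the usual unit-cost RAM model. *)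

theory Defs
  imports Complex_Main "HOL-Library.Landau_Symbols"
begin

subsection \<open>Graphs\<close>

record 'a ugraph =
  verts :: "'a set"
  edges :: "'a set set"

definition simple_graph :: "'a ugraph \<Rightarrow> bool" where
  "simple_graph G \<longleftrightarrow>
     finite (verts G) \<and> (\<forall>e \<in> edges G. e \<subseteq> verts G \<and> card e = 2)"

definition is_path :: "'a ugraph \<Rightarrow> 'a list \<Rightarrow> bool" where
  "is_path G xs \<longleftrightarrow>
     xs \<noteq> [] \<and> distinct xs \<and> set xs \<subseteq> verts G \<and> successively (\<lambda>u v. {u, v} \<in> edges G) xs"

definition path_between :: "'a ugraph \<Rightarrow> 'a \<Rightarrow> 'a list \<Rightarrow> 'a \<Rightarrow> bool" where
  "path_between G u xs v \<longleftrightarrow> is_path G xs \<and> hd xs = u \<and> last xs = v"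

definition connected_graph :: "'a ugraph \<Rightarrow> bool" where
  "connected_graph G \<longleftrightarrow>
     verts G \<noteq> {} \<and> (\<forall>u \<in> verts G. \<forall>v \<in> verts G. \<exists>xs. path_between G u xs v)"

text \<open>Number of edges of a shortest path; only meaningful if \<open>u\<close> and \<open>v\<close> are connected.\<close>

definition gdist :: "'a ugraph \<Rightarrow> 'a \<Rightarrow> 'a \<Rightarrow> nat" where
  "gdist G u v = (LEAST k. \<exists>xs. path_between G u xs v \<and> length xs = Suc k)"

definition is_cycle :: "'a ugraph \<Rightarrow> bool" where
  "is_cycle G \<longleftrightarrow>
     (\<exists>vs. 3 \<le> length vs \<and> distinct vs \<and> verts G = set vs \<and>
           edges G = {{vs ! i, vs ! (Suc i mod length vs)} | i. i < length vs})"


subsection \<open>Prioritized Voronoi diagrams and Balanced Vertex\<close>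

definition proper_vertex_list :: "'a ugraph \<Rightarrow> 'a list \<Rightarrow> bool" where
  "proper_vertex_list G S \<longleftrightarrow> distinct S \<and> set S \<subseteq> verts G"

definition gdist_list :: "'a ugraph \<Rightarrow> 'a \<Rightarrow> 'a list \<Rightarrow> nat" where
  "gdist_list G v S = Min (gdist G v ` set S)"

text \<open>Sites are addressed by their position in the list, counted from \<open>0\<close>.\<close>

definition territory :: "'a ugraph \<Rightarrow> 'a list \<Rightarrow> nat \<Rightarrow> 'a set" where
  "territory G S i =
     {v \<in> verts G. gdist G v (S ! i) = gdist_list G v S \<and>
                   (\<forall>j < i. gdist G v (S ! j) > gdist_list G v S)}"

definition load :: "'a ugraph \<Rightarrow> ('a \<Rightarrow> real) \<Rightarrow> 'a list \<Rightarrow> nat \<Rightarrow> real" where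
  "load G \<pi> S i = (\<Sum>v \<in> territory G S i. \<pi> v)"

definition max_load :: "'a ugraph \<Rightarrow> ('a \<Rightarrow> real) \<Rightarrow> 'a list \<Rightarrow> real" where
  "max_load G \<pi> S = Max (load G \<pi> S ` {..<length S})"

text \<open>
  An instance must have at least one admissible output, so \<open>S\<close> may not exhaust the vertices.
  The empty list \<open>S\<close> is allowed: only \<open>S + v\<close>, which is never empty, has its load evaluated.
\<close>

definition balanced_vertex_instance :: "'a ugraph \<Rightarrow> ('a \<Rightarrow> real) \<Rightarrow> 'a list \<Rightarrow> bool" where
  "balanced_vertex_instance G \<pi> S \<longleftrightarrow>
     simple_graph G \<and> connected_graph G \<and> (\<forall>v \<in> verts G. 0 \<le> \<pi> v) \<and>
     proper_vertex_list G S \<and> verts G - set S \<noteq> {}"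

definition balanced_vertex :: "'a ugraph \<Rightarrow> ('a \<Rightarrow> real) \<Rightarrow> 'a list \<Rightarrow> 'a \<Rightarrow> bool" where
  "balanced_vertex G \<pi> S v \<longleftrightarrow>
     v \<in> verts G - set S \<and>
     (\<forall>w \<in> verts G - set S. max_load G \<pi> (S @ [v]) \<le> max_load G \<pi> (S @ [w]))"


subsection \<open>The unit-cost random access machine\<close>

text \<open>
  Vertex costs are arbitrary reals, so besides natural numbers, which are used for addressing, the
  machine handles real numbers as atomic values (as in the real RAM). Each sort has registers, named
  directly by the instructions, and a memory, accessed through an address held in a natural number
  register. Arithmetic is restricted to addition and subtraction (truncated on the natural
  numbers), as in the machine of Cook and Reckhow: no unit-cost multiplication is available, nor
  any rounding or other conversion of reals to natural numbers.
\<close>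

datatype instr =
    IConst nat nat
  | IMove nat nat
  | IAdd nat nat nat
  | ISub nat nat nat
  | ILoad nat nat
  | IStore nat nat
  | RMove nat nat
  | RAdd nat nat nat
  | RSub nat nat nat
  | RLoad nat nat
  | RStore nat nat
  | Jump nat
  | IJumpLe nat nat nat
  | RJumpLe nat nat nat

record ram_state =
  pc :: nat
  ireg :: "nat \<Rightarrow> nat"
  imem :: "nat \<Rightarrow> nat"
  rreg :: "nat \<Rightarrow> real"
  rmem :: "nat \<Rightarrow> real"

definition next_pc :: "ram_state \<Rightarrow> ram_state" where
  "next_pc s = s\<lparr>pc := Suc (pc s)\<rparr>"

fun exec_instr :: "instr \<Rightarrow> ram_state \<Rightarrow> ram_state" where
  "exec_instr (IConst a k) s = next_pc (s\<lparr>ireg := (ireg s)(a := k)\<rparr>)"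
| "exec_instr (IMove a b) s = next_pc (s\<lparr>ireg := (ireg s)(a := ireg s b)\<rparr>)"
| "exec_instr (IAdd a b c) s = next_pc (s\<lparr>ireg := (ireg s)(a := ireg s b + ireg s c)\<rparr>)"
| "exec_instr (ISub a b c) s = next_pc (s\<lparr>ireg := (ireg s)(a := ireg s b - ireg s c)\<rparr>)"
| "exec_instr (ILoad a b) s = next_pc (s\<lparr>ireg := (ireg s)(a := imem s (ireg s b))\<rparr>)"
| "exec_instr (IStore a b) s = next_pc (s\<lparr>imem := (imem s)(ireg s a := ireg s b)\<rparr>)"
| "exec_instr (RMove a b) s = next_pc (s\<lparr>rreg := (rreg s)(a := rreg s b)\<rparr>)"
| "exec_instr (RAdd a b c) s = next_pc (s\<lparr>rreg := (rreg s)(a := rreg s b + rreg s c)\<rparr>)"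
| "exec_instr (RSub a b c) s = next_pc (s\<lparr>rreg := (rreg s)(a := rreg s b - rreg s c)\<rparr>)"
| "exec_instr (RLoad a b) s = next_pc (s\<lparr>rreg := (rreg s)(a := rmem s (ireg s b))\<rparr>)"
| "exec_instr (RStore a b) s = next_pc (s\<lparr>rmem := (rmem s)(ireg s a := rreg s b)\<rparr>)"
| "exec_instr (Jump l) s = s\<lparr>pc := l\<rparr>"
| "exec_instr (IJumpLe a b l) s = (if ireg s a \<le> ireg s b then s\<lparr>pc := l\<rparr> else next_pc s)"
| "exec_instr (RJumpLe a b l) s = (if rreg s a \<le> rreg s b then s\<lparr>pc := l\<rparr> else next_pc s)"

text \<open>
  The machine halts by leaving its program. A halted state is a fixed point of \<open>ram_step\<close>, hence
  being halted after \<open>t\<close> steps means that at most \<open>t\<close> instructions are executed in total.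
\<close>

definition halted :: "instr list \<Rightarrow> ram_state \<Rightarrow> bool" where
  "halted P s \<longleftrightarrow> length P \<le> pc s"

definition ram_step :: "instr list \<Rightarrow> ram_state \<Rightarrow> ram_state" where
  "ram_step P s = (if halted P s then s else exec_instr (P ! pc s) s)"

definition ram_run :: "instr list \<Rightarrow> nat \<Rightarrow> ram_state \<Rightarrow> ram_state" where
  "ram_run P t = ram_step P ^^ t"

definition init_state :: "nat list \<Rightarrow> real list \<Rightarrow> ram_state" where
  "init_state xs rs =
     \<lparr>pc = 0, ireg = (\<lambda>_. 0), imem = (\<lambda>i. if i < length xs then xs ! i else 0),
      rreg = (\<lambda>_. 0), rmem = (\<lambda>i. if i < length rs then rs ! i else 0)\<rparr>"


subsection \<open>Algorithms for Balanced Vertex\<close>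

text \<open>
  The vertices of an input graph are the numbers below \<open>n\<close>. The graph is given by adjacency lists,
  in which neighbours may appear in any order; each list is preceded by its length. In particular,
  the numbering of the vertices of a cycle is unrelated to their order along the cycle.
\<close>

definition adjacency_lists :: "nat ugraph \<Rightarrow> nat list list \<Rightarrow> bool" where
  "adjacency_lists G adj \<longleftrightarrow>
     verts G = {..<length adj} \<and>
     (\<forall>v < length adj. distinct (adj ! v) \<and> set (adj ! v) = {w. {v, w} \<in> edges G})"

definition encode_input :: "nat list list \<Rightarrow> nat list \<Rightarrow> nat list" where
  "encode_input adj S =
     [length adj, length S] @ S @ concat (map (\<lambda>ws. length ws # ws) adj)"

text \<open>
  The program \<open>P\<close> solves Balanced Vertex on all instances whose graph satisfies \<open>C\<close>, with worst-case
  running time at most \<open>T n\<close> on graphs with \<open>n\<close> vertices. The output is the final content of natural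
  number register \<open>0\<close>.
\<close>

definition solves_balanced_vertex ::
  "instr list \<Rightarrow> (nat ugraph \<Rightarrow> bool) \<Rightarrow> (nat \<Rightarrow> nat) \<Rightarrow> bool" where
  "solves_balanced_vertex P C T \<longleftrightarrow>
     (\<forall>G \<pi> S adj n. C G \<and> card (verts G) = n \<and> balanced_vertex_instance G \<pi> S \<and>
        adjacency_lists G adj \<longrightarrow>
        (let s = ram_run P (T n) (init_state (encode_input adj S) (map \<pi> [0..<n]))
         in halted P s \<and> balanced_vertex G \<pi> S (ireg s 0)))"

end

theory Submission
  imports Defs
begin

text \<open>
  Cut the cycle open at the first site, which becomes both ends of a line of positions
  \<open>0, \<dots>, n\<close>. Territories are then intervals whose boundaries are midpoints of consecutive sites,
  so with prefix sums of the costs every load is a difference of two entries. Halving is avoided by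
  indexing the prefix sums by doubled positions. A new site \<open>x\<close> between consecutive sites \<open>l\<close> and
  \<open>r\<close> has the lowest priority and changes only the loads of \<open>l\<close> and \<open>r\<close>: its territory consists
  of the \<open>y\<close> with \<open>x + l < 2 * y < x + r\<close>. With the maximal load to the left of \<open>l\<close> (maintained by
  the final scan) and to the right of \<open>r\<close> (precomputed backwards), \<open>L(S + x)\<close> takes constant time.
\<close>


subsection \<open>Structured programs for the random access machine\<close>

text \<open>Ties shape the construction. A boundary is the sum of two consecutive sites, increased
  by one exactly when the left site has priority; a strict comparison with \<open>2 * y\<close> then
  settles ties without computing any distance. Cutting turns the first site into two sites of the
  line, whose pieces add up to one load. Both pieces may nevertheless enter the maxima separately:
  costs are nonnegative, so each piece is at most their sum, which is a candidate as well. The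
  vertex numbers do not reveal the order along the cycle, so the line must be recovered by a walk.
  It starts at the first site and moves away from the neighbour listed second there; either
  direction would do, and the enumeration in the proof is chosen to agree with this one. An empty
  list offers no place to cut. Then every vertex receives the total cost, so vertex 0 is an answer.
  Each loop runs a number of rounds known in advance, which makes its time a constant times that
  number; the four loops together need at most 8 + 24 + 42 + 82 = 156 steps per vertex.\<close>

datatype com =
    Skip
  | Ins instr
  | Seq com com (infixr \<open>;;\<close> 60)
  | IfI nat nat com com
  | IfR nat nat com com
  | While nat nat com

fun len :: "com \<Rightarrow> nat" where
  "len Skip = 0"
| "len (Ins i) = 1"
| "len (c ;; d) = len c + len d"
| "len (IfI a b c d) = len c + len d + 2"
| "len (IfR a b c d) = len c + len d + 2"
| "len (While a b c) = len c + 2"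

text \<open>\<open>IfI a b c d\<close> runs \<open>c\<close> if register \<open>a\<close> is at most register \<open>b\<close>, whereas \<open>While a b c\<close> runs
  \<open>c\<close> as long as register \<open>a\<close> exceeds register \<open>b\<close>. Jumps are absolute, so code depends on its
  address.\<close>

fun compile :: "com \<Rightarrow> nat \<Rightarrow> instr list" where
  "compile Skip k = []"
| "compile (Ins i) k = [i]"
| "compile (c ;; d) k = compile c k @ compile d (k + len c)"
| "compile (IfI a b c d) k =
     IJumpLe a b (k + len d + 2) # compile d (k + 1) @
     Jump (k + len d + 2 + len c) # compile c (k + len d + 2)"
| "compile (IfR a b c d) k =
     RJumpLe a b (k + len d + 2) # compile d (k + 1) @
     Jump (k + len d + 2 + len c) # compile c (k + len d + 2)"
| "compile (While a b c) k = IJumpLe a b (k + len c + 2) # compile c (k + 1) @ [Jump k]"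

lemma length_compile [simp]: "length (compile c k) = len c"
  by (induction c arbitrary: k) auto

text \<open>Leaving out the program counter gives straight-line and branching code a meaning that
  does not depend on its address.\<close>

fun eff :: "instr \<Rightarrow> ram_state \<Rightarrow> ram_state" where
  "eff (IConst a k) s = s\<lparr>ireg := (ireg s)(a := k)\<rparr>"
| "eff (IMove a b) s = s\<lparr>ireg := (ireg s)(a := ireg s b)\<rparr>"
| "eff (IAdd a b c) s = s\<lparr>ireg := (ireg s)(a := ireg s b + ireg s c)\<rparr>"
| "eff (ISub a b c) s = s\<lparr>ireg := (ireg s)(a := ireg s b - ireg s c)\<rparr>"
| "eff (ILoad a b) s = s\<lparr>ireg := (ireg s)(a := imem s (ireg s b))\<rparr>"
| "eff (IStore a b) s = s\<lparr>imem := (imem s)(ireg s a := ireg s b)\<rparr>"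
| "eff (RMove a b) s = s\<lparr>rreg := (rreg s)(a := rreg s b)\<rparr>"
| "eff (RAdd a b c) s = s\<lparr>rreg := (rreg s)(a := rreg s b + rreg s c)\<rparr>"
| "eff (RSub a b c) s = s\<lparr>rreg := (rreg s)(a := rreg s b - rreg s c)\<rparr>"
| "eff (RLoad a b) s = s\<lparr>rreg := (rreg s)(a := rmem s (ireg s b))\<rparr>"
| "eff (RStore a b) s = s\<lparr>rmem := (rmem s)(ireg s a := rreg s b)\<rparr>"
| "eff _ s = s"

fun is_jump :: "instr \<Rightarrow> bool" where
  "is_jump (Jump _) = True"
| "is_jump (IJumpLe _ _ _) = True"
| "is_jump (RJumpLe _ _ _) = True"
| "is_jump _ = False"

fun loop_free :: "com \<Rightarrow> bool" where
  "loop_free Skip = True"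
| "loop_free (Ins i) = (\<not> is_jump i)"
| "loop_free (c ;; d) = (loop_free c \<and> loop_free d)"
| "loop_free (IfI a b c d) = (loop_free c \<and> loop_free d)"
| "loop_free (IfR a b c d) = (loop_free c \<and> loop_free d)"
| "loop_free (While a b c) = False"

text \<open>The value on loops is junk.\<close>

fun sem :: "com \<Rightarrow> ram_state \<Rightarrow> ram_state" where
  "sem Skip s = s"
| "sem (Ins i) s = eff i s"
| "sem (c ;; d) s = sem d (sem c s)"
| "sem (IfI a b c d) s = (if ireg s a \<le> ireg s b then sem c s else sem d s)"
| "sem (IfR a b c d) s = (if rreg s a \<le> rreg s b then sem c s else sem d s)"
| "sem (While a b c) s = s"

lemma exec_instr_eff: "\<not> is_jump i \<Longrightarrow> exec_instr i s = (eff i s)\<lparr>pc := Suc (pc s)\<rparr>"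
  by (cases i) (auto simp: next_pc_def)

lemma eff_pc: "eff i (s\<lparr>pc := k\<rparr>) = (eff i s)\<lparr>pc := k\<rparr>"
  by (cases i) auto

lemma sem_pc: "sem c (s\<lparr>pc := k\<rparr>) = (sem c s)\<lparr>pc := k\<rparr>"
  by (induction c arbitrary: s) (auto simp: eff_pc)

section \<open>Execution of compiled code inside a larger program\<close>

definition code_at :: "instr list \<Rightarrow> nat \<Rightarrow> instr list \<Rightarrow> bool" where
  "code_at P k xs \<longleftrightarrow> (\<forall>i < length xs. k + i < length P \<and> P ! (k + i) = xs ! i)"

lemma code_at_Nil [simp]: "code_at P k []"
  by (simp add: code_at_def)

lemma code_at_Cons [simp]:
  "code_at P k (x # xs) \<longleftrightarrow> k < length P \<and> P ! k = x \<and> code_at P (Suc k) xs"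
  unfolding code_at_def by (auto simp: less_Suc_eq_0_disj)

lemma code_at_append [simp]:
  "code_at P k (xs @ ys) \<longleftrightarrow> code_at P k xs \<and> code_at P (k + length xs) ys"
  by (induction xs arbitrary: k) auto

lemma code_at_self: "code_at P 0 P"
  by (simp add: code_at_def)

lemma ram_run_0 [simp]: "ram_run P 0 s = s"
  by (simp add: ram_run_def)

lemma ram_run_add: "ram_run P (t + u) s = ram_run P u (ram_run P t s)"
  by (simp add: ram_run_def add.commute[of t] funpow_add)

lemma ram_run_Suc: "ram_run P (Suc t) s = ram_run P t (ram_step P s)"
  using ram_run_add[of P 1 t s] by (simp add: ram_run_def)

lemma ram_step_at: "\<lbrakk>k < length P; P ! k = i; pc s = k\<rbrakk> \<Longrightarrow> ram_step P s = exec_instr i s"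
  by (auto simp: ram_step_def halted_def)

text \<open>A bound instead of an exact step count lets the two arms of a branch share one
  figure.\<close>

definition reach :: "instr list \<Rightarrow> nat \<Rightarrow> ram_state \<Rightarrow> ram_state \<Rightarrow> bool" where
  "reach P t s s' \<longleftrightarrow> (\<exists>u \<le> t. ram_run P u s = s')"

lemma reach_refl [simp]: "reach P t s s"
  unfolding reach_def by (rule exI[of _ 0]) simp

lemma reach_trans: "\<lbrakk>reach P t s s'; reach P u s' s''; t + u \<le> v\<rbrakk> \<Longrightarrow> reach P v s s''"
  unfolding reach_def by (metis add_le_mono order_trans ram_run_add)

lemma reach_step: "\<lbrakk>k < length P; P ! k = i; pc s = k\<rbrakk> \<Longrightarrow> reach P 1 s (exec_instr i s)"
  unfolding reach_def by (rule exI[of _ 1]) (simp add: ram_run_Suc ram_step_at)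

text \<open>Charging both arms of a branch is crude, but a loop body only needs a constant bound.
  The extra 2 pays for the test and for the jump over the other arm.\<close>

fun cost :: "com \<Rightarrow> nat" where
  "cost Skip = 0"
| "cost (Ins i) = 1"
| "cost (c ;; d) = cost c + cost d"
| "cost (IfI a b c d) = cost c + cost d + 2"
| "cost (IfR a b c d) = cost c + cost d + 2"
| "cost (While a b c) = 0"

text \<open>Induction over the command with its address generalized. The code of \<open>d\<close>
  precedes that of \<open>c\<close>, so only the arm \<open>d\<close> executes the closing
  jump.\<close>

lemma reach_sem:
  "\<lbrakk>loop_free c; code_at P k (compile c k); pc s = k\<rbrakk>
   \<Longrightarrow> reach P (cost c) s ((sem c s)\<lparr>pc := k + len c\<rparr>)"
proof (induction c arbitrary: k s)
  case Skip
  then have "s = s\<lparr>pc := k\<rparr>" by simp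
  then show ?case by (metis add_0_right len.simps(1) reach_refl sem.simps(1))
next
  case (Ins i)
  then have "reach P 1 s (exec_instr i s)" by (intro reach_step) auto
  then show ?case using Ins by (simp add: exec_instr_eff)
next
  case (Seq c d)
  have "reach P (cost c) s ((sem c s)\<lparr>pc := k + len c\<rparr>)"
    using Seq by (intro Seq.IH) auto
  moreover have "reach P (cost d) ((sem c s)\<lparr>pc := k + len c\<rparr>)
      ((sem d ((sem c s)\<lparr>pc := k + len c\<rparr>))\<lparr>pc := k + len c + len d\<rparr>)"
    using Seq by (intro Seq.IH) auto
  ultimately show ?case by (auto intro: reach_trans simp: sem_pc add.assoc)
next
  case (IfI a b c d)
  have j: "reach P 1 s (exec_instr (IJumpLe a b (k + len d + 2)) s)"
    using IfI by (intro reach_step) auto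
  show ?case
  proof (cases "ireg s a \<le> ireg s b")
    case True
    have "reach P (cost c) (s\<lparr>pc := k + len d + 2\<rparr>)
      ((sem c (s\<lparr>pc := k + len d + 2\<rparr>))\<lparr>pc := k + len d + 2 + len c\<rparr>)"
      using IfI by (intro IfI.IH) (auto simp: numeral_2_eq_2)
    then show ?thesis
      using True j by (auto intro!: reach_trans[OF j] simp: sem_pc algebra_simps)
  next
    case False
    have "reach P (cost d) (s\<lparr>pc := k + 1\<rparr>)
      ((sem d (s\<lparr>pc := k + 1\<rparr>))\<lparr>pc := k + 1 + len d\<rparr>)"
      using IfI by (intro IfI.IH) (auto simp: numeral_2_eq_2)
    moreover have "reach P 1 s (s\<lparr>pc := k + 1\<rparr>)"
      using False j IfI.prems by (simp add: next_pc_def)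
    ultimately have A: "reach P (1 + cost d) s ((sem d s)\<lparr>pc := k + 1 + len d\<rparr>)"
      by (auto simp: sem_pc dest: reach_trans)
    have "reach P 1 ((sem d s)\<lparr>pc := k + 1 + len d\<rparr>)
       (exec_instr (Jump (k + len d + 2 + len c)) ((sem d s)\<lparr>pc := k + 1 + len d\<rparr>))"
      using IfI by (intro reach_step) auto
    from reach_trans[OF A this] show ?thesis using False by (auto simp: algebra_simps)
  qed
next
  case (IfR a b c d)
  have j: "reach P 1 s (exec_instr (RJumpLe a b (k + len d + 2)) s)"
    using IfR by (intro reach_step) auto
  show ?case
  proof (cases "rreg s a \<le> rreg s b")
    case True
    have "reach P (cost c) (s\<lparr>pc := k + len d + 2\<rparr>)
      ((sem c (s\<lparr>pc := k + len d + 2\<rparr>))\<lparr>pc := k + len d + 2 + len c\<rparr>)"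
      using IfR by (intro IfR.IH) (auto simp: numeral_2_eq_2)
    then show ?thesis
      using True j by (auto intro!: reach_trans[OF j] simp: sem_pc algebra_simps)
  next
    case False
    have "reach P (cost d) (s\<lparr>pc := k + 1\<rparr>)
      ((sem d (s\<lparr>pc := k + 1\<rparr>))\<lparr>pc := k + 1 + len d\<rparr>)"
      using IfR by (intro IfR.IH) (auto simp: numeral_2_eq_2)
    moreover have "reach P 1 s (s\<lparr>pc := k + 1\<rparr>)"
      using False j IfR.prems by (simp add: next_pc_def)
    ultimately have A: "reach P (1 + cost d) s ((sem d s)\<lparr>pc := k + 1 + len d\<rparr>)"
      by (auto simp: sem_pc dest: reach_trans)
    have "reach P 1 ((sem d s)\<lparr>pc := k + 1 + len d\<rparr>)
       (exec_instr (Jump (k + len d + 2 + len c)) ((sem d s)\<lparr>pc := k + 1 + len d\<rparr>))"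
      using IfR by (intro reach_step) auto
    from reach_trans[OF A this] show ?thesis using False by (auto simp: algebra_simps)
  qed
qed simp

text \<open>Timed total correctness. Resetting the program counter makes assertions independent of the
  location of the code.\<close>

definition ht :: "(ram_state \<Rightarrow> bool) \<Rightarrow> com \<Rightarrow> nat \<Rightarrow> (ram_state \<Rightarrow> bool) \<Rightarrow> bool" where
  "ht Pre c t Post \<longleftrightarrow>
     (\<forall>P k s. code_at P k (compile c k) \<and> pc s = k \<and> Pre (s\<lparr>pc := 0\<rparr>) \<longrightarrow>
        (\<exists>s'. reach P t s s' \<and> pc s' = k + len c \<and> Post (s'\<lparr>pc := 0\<rparr>)))"

lemma htD:
  assumes "ht Pre c t Post" and "code_at P k (compile c k)" and "pc s = k" and "Pre (s\<lparr>pc := 0\<rparr>)"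
  obtains s' where "reach P t s s'" and "pc s' = k + len c" and "Post (s'\<lparr>pc := 0\<rparr>)"
  using assms unfolding ht_def by blast

text \<open>Loop-free code is verified by simplifying \<open>sem\<close>; only loops are left to the
  rules below.\<close>

lemma ht_sem:
  assumes "loop_free c" and "cost c \<le> t" and "\<And>s. Pre s \<Longrightarrow> Post (sem c s)"
  shows "ht Pre c t Post"
  unfolding ht_def
proof (intro allI impI, elim conjE)
  fix P k s assume "code_at P k (compile c k)" "pc s = k" "Pre (s\<lparr>pc := 0\<rparr>)"
  then have "reach P (cost c) s ((sem c s)\<lparr>pc := k + len c\<rparr>)"
    and "Post ((sem c s)\<lparr>pc := 0\<rparr>)"
    using reach_sem[OF assms(1)] assms(3)[of "s\<lparr>pc := 0\<rparr>"] by (auto simp: sem_pc)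
  then show "\<exists>s'. reach P t s s' \<and> pc s' = k + len c \<and> Post (s'\<lparr>pc := 0\<rparr>)"
    using assms(2) by (intro exI[of _ "(sem c s)\<lparr>pc := k + len c\<rparr>"])
      (auto intro: reach_trans[where u = 0])
qed

lemma ht_weaken:
  assumes "ht P c t Q" and "\<And>s. P' s \<Longrightarrow> P s" and "\<And>s. Q s \<Longrightarrow> Q' s" and "t \<le> t'"
  shows "ht P' c t' Q'"
proof -
  have "reach R t' s s'" if "reach R t s s'" for R s s'
    using that reach_trans[OF that reach_refl[of _ 0]] assms(4) by simp
  then show ?thesis using assms(1-3) unfolding ht_def by blast
qed

lemma ht_seq:
  assumes "ht P c t Q" and "ht Q d u R"
  shows "ht P (c ;; d) (t + u) R"
  unfolding ht_def
proof (intro allI impI, elim conjE)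
  fix p k s assume A: "code_at p k (compile (c ;; d) k)" "pc s = k" "P (s\<lparr>pc := 0\<rparr>)"
  then obtain s' where s': "reach p t s s'" "pc s' = k + len c" "Q (s'\<lparr>pc := 0\<rparr>)"
    using htD[OF assms(1), of p k s] by auto
  moreover obtain s'' where "reach p u s' s''" "pc s'' = k + len c + len d" "R (s''\<lparr>pc := 0\<rparr>)"
    using htD[OF assms(2), of p "k + len c" s'] s' A by auto
  ultimately show "\<exists>s'. reach p (t + u) s s' \<and> pc s' = k + len (c ;; d) \<and> R (s'\<lparr>pc := 0\<rparr>)"
    by (auto intro: reach_trans simp: add.assoc)
qed

text \<open>The invariant is indexed by the number of completed rounds, and the guard determines the
  index at which the loop ends, so termination and running time need no separate variant. A round
  pays for its test and the jump back; the failing test adds 1.\<close>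

lemma ht_while:
  assumes body: "\<And>k. k < N \<Longrightarrow> ht (I k) c t (I (Suc k))"
    and guard: "\<And>k s. k \<le> N \<Longrightarrow> I k s \<Longrightarrow> ireg s a \<le> ireg s b \<longleftrightarrow> k = N"
  shows "ht (I 0) (While a b c) (N * (t + 2) + 1) (I N)"
  unfolding ht_def
proof (intro allI impI, elim conjE)
  fix P k s
  assume code: "code_at P k (compile (While a b c) k)" and "pc s = k" "I 0 (s\<lparr>pc := 0\<rparr>)"
  have step: "\<exists>s'. reach P (m * (t + 2)) s s' \<and> pc s' = k \<and> I m (s'\<lparr>pc := 0\<rparr>)" if "m \<le> N" for m
    using that
  proof (induction m)
    case 0
    show ?case using \<open>pc s = k\<close> \<open>I 0 _\<close> by (intro exI[of _ s]) auto
  next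
    case (Suc m)
    then obtain s' where s': "reach P (m * (t + 2)) s s'" "pc s' = k" "I m (s'\<lparr>pc := 0\<rparr>)"
      by auto
    have "reach P 1 s' (exec_instr (IJumpLe a b (k + len c + 2)) s')"
      using code s' by (intro reach_step) auto
    then have 1: "reach P 1 s' (s'\<lparr>pc := Suc k\<rparr>)"
      using guard[OF _ s'(3)] Suc.prems s'(2) by (auto simp: next_pc_def)
    obtain s'' where s'': "reach P t (s'\<lparr>pc := Suc k\<rparr>) s''" "pc s'' = Suc k + len c"
        "I (Suc m) (s''\<lparr>pc := 0\<rparr>)"
      using htD[OF body[of m], of P "Suc k" "s'\<lparr>pc := Suc k\<rparr>"] Suc.prems s'(3) code by auto
    have "reach P 1 s'' (exec_instr (Jump k) s'')"
      using code s'' by (intro reach_step) auto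
    then have 2: "reach P (Suc t) (s'\<lparr>pc := Suc k\<rparr>) (s''\<lparr>pc := k\<rparr>)"
      by (auto intro: reach_trans[OF s''(1)])
    have "reach P (t + 2) s' (s''\<lparr>pc := k\<rparr>)" by (rule reach_trans[OF 1 2]) auto
    then have "reach P (Suc m * (t + 2)) s (s''\<lparr>pc := k\<rparr>)"
      by (auto intro: reach_trans[OF s'(1)])
    then show ?case using s'' by (intro exI[of _ "s''\<lparr>pc := k\<rparr>"]) auto
  qed
  obtain s' where s': "reach P (N * (t + 2)) s s'" "pc s' = k" "I N (s'\<lparr>pc := 0\<rparr>)"
    using step[of N] by auto
  have "reach P 1 s' (exec_instr (IJumpLe a b (k + len c + 2)) s')"
    using code s' by (intro reach_step) auto
  then have "reach P 1 s' (s'\<lparr>pc := k + len c + 2\<rparr>)"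
    using guard[OF _ s'(3)] by simp
  then have "reach P (N * (t + 2) + 1) s (s'\<lparr>pc := k + len c + 2\<rparr>)"
    by (auto intro: reach_trans[OF s'(1)])
  then show "\<exists>s'. reach P (N * (t + 2) + 1) s s' \<and> pc s' = k + len (While a b c) \<and>
      I N (s'\<lparr>pc := 0\<rparr>)"
    using s' by (intro exI[of _ "s'\<lparr>pc := k + len c + 2\<rparr>"]) auto
qed

text \<open>Serves branches with a loop in one arm, where \<open>sem\<close> is meaningless.\<close>

lemma ht_IfI:
  assumes c: "ht (\<lambda>s. Pre s \<and> ireg s a \<le> ireg s b) c t Post"
    and d: "ht (\<lambda>s. Pre s \<and> \<not> ireg s a \<le> ireg s b) d t Post"
  shows "ht Pre (IfI a b c d) (t + 2) Post"
  unfolding ht_def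
proof (intro allI impI, elim conjE)
  fix P k s
  assume code: "code_at P k (compile (IfI a b c d) k)" and k: "pc s = k" and Pre: "Pre (s\<lparr>pc := 0\<rparr>)"
  have 1: "reach P 1 s (exec_instr (IJumpLe a b (k + len d + 2)) s)"
    using code k by (intro reach_step) auto
  show "\<exists>s'. reach P (t + 2) s s' \<and> pc s' = k + len (IfI a b c d) \<and> Post (s'\<lparr>pc := 0\<rparr>)"
  proof (cases "ireg s a \<le> ireg s b")
    case True
    obtain s' where "reach P t (s\<lparr>pc := k + len d + 2\<rparr>) s'" "pc s' = k + len d + 2 + len c"
        "Post (s'\<lparr>pc := 0\<rparr>)"
      using htD[OF c, of P "k + len d + 2" "s\<lparr>pc := k + len d + 2\<rparr>"] code Pre True by auto
    then show ?thesis using True reach_trans[OF 1, of t s' "t + 2"] by auto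
  next
    case False
    obtain s' where s': "reach P t (s\<lparr>pc := k + 1\<rparr>) s'" "pc s' = k + 1 + len d"
        "Post (s'\<lparr>pc := 0\<rparr>)"
      using htD[OF d, of P "k + 1" "s\<lparr>pc := k + 1\<rparr>"] code Pre False by auto
    have "reach P 1 s' (exec_instr (Jump (k + len d + 2 + len c)) s')"
      using code s' by (intro reach_step) auto
    then have "reach P (t + 1) (s\<lparr>pc := k + 1\<rparr>) (s'\<lparr>pc := k + len d + 2 + len c\<rparr>)"
      using reach_trans[OF s'(1)] by simp
    then have "reach P (t + 2) s (s'\<lparr>pc := k + len d + 2 + len c\<rparr>)"
      using False k reach_trans[OF 1] by (simp add: next_pc_def)
    then show ?thesis using s' by (intro exI[of _ "s'\<lparr>pc := k + len d + 2 + len c\<rparr>"]) auto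
  qed
qed

lemma ht_absurd: "(\<And>s. \<not> Pre s) \<Longrightarrow> ht Pre c t Post"
  by (simp add: ht_def)

lemma ram_run_halted: "halted P s \<Longrightarrow> ram_run P t s = s"
  by (induction t) (simp_all add: ram_run_Suc ram_step_def)

text \<open>A halted state no longer changes, so reaching the end within \<open>t\<close> steps
  determines the state after any \<open>T \<ge> t\<close> steps.\<close>

lemma ht_run:
  assumes "ht (\<lambda>s. s = s0) c t Post" "pc s0 = 0" "t \<le> T"
    and Post: "\<And>s k. Post (s\<lparr>pc := k\<rparr>) = Post s"
  shows "halted (compile c 0) (ram_run (compile c 0) T s0) \<and> Post (ram_run (compile c 0) T s0)"
proof -
  let ?P = "compile c 0"
  have s0: "s0\<lparr>pc := 0\<rparr> = s0" using assms(2) by simp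
  obtain s' where s': "reach ?P t s0 s'" "pc s' = 0 + len c" "Post (s'\<lparr>pc := 0\<rparr>)"
    using htD[OF assms(1) code_at_self assms(2) s0] by auto
  then obtain u where u: "u \<le> t" "ram_run ?P u s0 = s'" by (auto simp: reach_def)
  have h: "halted ?P s'" using s' by (simp add: halted_def)
  have "ram_run ?P T s0 = ram_run ?P (T - u) s'"
    using ram_run_add[of ?P u "T - u" s0] u assms(3) by simp
  then show ?thesis using h s' by (simp add: ram_run_halted Post)
qed


subsection \<open>Distances on a cycle\<close>

text \<open>Indexing by all integers hides the wrap-around: rotation, reflection and the two
  neighbours become plain arithmetic on indices.\<close>

definition cyc_enum :: "'a ugraph \<Rightarrow> nat \<Rightarrow> (int \<Rightarrow> 'a) \<Rightarrow> bool" where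
  "cyc_enum G n c \<longleftrightarrow>
     3 \<le> n \<and> verts G = range c \<and> (\<forall>i j. c i = c j \<longleftrightarrow> i mod int n = j mod int n) \<and>
     edges G = range (\<lambda>i. {c i, c (i + 1)})"

lemma cyc_enum_shift:
  assumes "cyc_enum G n c" shows "cyc_enum G n (\<lambda>i. c (i + k))"
proof -
  have s: "range (\<lambda>i. f (i + k)) = range f" for f :: "int \<Rightarrow> 'b"
  proof -
    have "f x \<in> range (\<lambda>i. f (i + k))" for x by (rule image_eqI[of _ _ "x - k"]) auto
    then show ?thesis by auto
  qed
  have "(i + k) mod int n = (j + k) mod int n \<longleftrightarrow> i mod int n = j mod int n" for i j
    by (simp add: mod_eq_dvd_iff)
  then show ?thesis
    using assms s[of c] s[of "\<lambda>i. {c i, c (i + 1)}"]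
    unfolding cyc_enum_def by (simp add: add.assoc add.commute[of k])
qed

lemma cyc_enum_reflect:
  assumes "cyc_enum G n c" shows "cyc_enum G n (\<lambda>i. c (- i))"
proof -
  have s: "range (\<lambda>i. f (k - i)) = range f" for f :: "int \<Rightarrow> 'b" and k
  proof -
    have "f x \<in> range (\<lambda>i. f (k - i))" for x by (rule image_eqI[of _ _ "k - x"]) auto
    then show ?thesis by auto
  qed
  have "range (\<lambda>i. {c (- i), c (- (i + 1))}) = range (\<lambda>i. {c i, c (i + 1)})"
    using s[of "\<lambda>i. {c i, c (i + 1)}" "-1"] by (simp add: insert_commute minus_diff_commute)
  moreover have "(- i) mod int n = (- j) mod int n \<longleftrightarrow> i mod int n = j mod int n" for i j
    by (metis mod_minus_cong minus_minus)
  ultimately show ?thesis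
    using assms s[of c 0] unfolding cyc_enum_def by simp
qed

lemma is_cycle_enum:
  assumes "is_cycle G"
  obtains c where "cyc_enum G (card (verts G)) c"
proof -
  obtain vs where vs: "3 \<le> length vs" "distinct vs" "verts G = set vs"
    "edges G = {{vs ! i, vs ! (Suc i mod length vs)} | i. i < length vs}"
    using assms unfolding is_cycle_def by blast
  define n where "n = length vs"
  define c where "c i = vs ! nat (i mod int n)" for i
  have n: "3 \<le> n" "card (verts G) = n" using vs by (auto simp: n_def distinct_card)
  have lt: "nat (i mod int n) < n" for i using n by (simp add: nat_less_iff)
  have ci: "c (int i) = vs ! i" if "i < n" for i using that by (simp add: c_def)
  have 1: "verts G = range c"
  proof
    show "verts G \<subseteq> range c"
      using ci vs(3) by (auto simp: in_set_conv_nth n_def) (metis rangeI)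
    show "range c \<subseteq> verts G" using lt vs(3) by (auto simp: c_def n_def)
  qed
  have 2: "c i = c j \<longleftrightarrow> i mod int n = j mod int n" for i j
  proof -
    have "c i = c j \<longleftrightarrow> nat (i mod int n) = nat (j mod int n)"
      using lt vs(2) by (simp add: c_def nth_eq_iff_index_eq n_def)
    then show ?thesis using n by (simp add: eq_nat_nat_iff)
  qed
  have suc: "{vs ! k, vs ! (Suc k mod n)} = {c i, c (i + 1)}" if "k = nat (i mod int n)" for i k
  proof -
    have k: "int k = i mod int n" using that n by simp
    have "int (Suc k mod n) = (i + 1) mod int n"
      using mod_add_left_eq[of i "int n" 1] k by (simp add: zmod_int add.commute)
    then have "Suc k mod n = nat ((i + 1) mod int n)" by (metis nat_int)
    then show ?thesis using that by (simp add: c_def)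
  qed
  have 3: "edges G = range (\<lambda>i. {c i, c (i + 1)})"
  proof
    show "edges G \<subseteq> range (\<lambda>i. {c i, c (i + 1)})"
    proof
      fix e assume "e \<in> edges G"
      then obtain k where k: "k < n" "e = {vs ! k, vs ! (Suc k mod n)}" using vs(4) n_def by auto
      then have "k = nat (int k mod int n)" by simp
      then show "e \<in> range (\<lambda>i. {c i, c (i + 1)})" using suc[of k "int k"] k by blast
    qed
    show "range (\<lambda>i. {c i, c (i + 1)}) \<subseteq> edges G"
    proof
      fix e assume "e \<in> range (\<lambda>i. {c i, c (i + 1)})"
      then obtain i where "e = {c i, c (i + 1)}" by auto
      then show "e \<in> edges G" using suc[OF refl, of i] lt[of i] vs(4) n_def by auto
    qed
  qed
  show thesis using that[of c] n 1 2 3 by (simp add: cyc_enum_def)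
qed

lemma cyc_enum_neighbours:
  assumes "cyc_enum G n c"
  shows "{w. {c i, w} \<in> edges G} = {c (i - 1), c (i + 1)}"
proof -
  have ce: "c i = c j \<longleftrightarrow> int n dvd (i - j)" for i j
    using assms by (simp add: cyc_enum_def mod_eq_dvd_iff)
  have e: "edges G = range (\<lambda>i. {c i, c (i + 1)})" using assms by (simp add: cyc_enum_def)
  have "w \<in> {c (i - 1), c (i + 1)}" if ed: "{c i, w} \<in> edges G" for w
  proof -
    obtain j where j: "{c i, w} = {c j, c (j + 1)}" using ed e by auto
    then consider "c i = c j" "w = c (j + 1)" | "c i = c (j + 1)" "w = c j"
      by (auto simp: doubleton_eq_iff)
    then show ?thesis
    proof cases
      case 1
      then have "c (i + 1) = c (j + 1)" by (simp add: ce)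
      with 1 show ?thesis by simp
    next
      case 2
      then have "c (i - 1) = c j" by (simp add: ce algebra_simps)
      with 2 show ?thesis by simp
    qed
  qed
  moreover have "{c i, c (i - 1)} \<in> edges G"
    unfolding e by (rule image_eqI[of _ _ "i - 1"]) auto
  ultimately show ?thesis using e by auto
qed

text \<open>A walk lifts to the integers, since each edge changes the index by one in some
  direction.\<close>

lemma cyc_enum_walk:
  assumes "cyc_enum G n c"
  shows "xs \<noteq> [] \<Longrightarrow> successively (\<lambda>u v. {u, v} \<in> edges G) xs \<Longrightarrow> hd xs = c i \<Longrightarrow>
    \<exists>j. last xs = c j \<and> \<bar>j - i\<bar> < int (length xs)"
proof (induction xs arbitrary: i)
  case (Cons x xs)
  show ?case
  proof (cases "xs = []")
    case True
    then show ?thesis using Cons.prems by (intro exI[of _ i]) auto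
  next
    case False
    then have "{c i, hd xs} \<in> edges G" and s: "successively (\<lambda>u v. {u, v} \<in> edges G) xs"
      using Cons.prems by (auto simp: successively_Cons)
    then have "hd xs \<in> {c (i - 1), c (i + 1)}"
      using cyc_enum_neighbours[OF assms] by blast
    then obtain k where k: "hd xs = c k" "\<bar>k - i\<bar> \<le> 1" by force
    obtain j where "last xs = c j" "\<bar>j - k\<bar> < int (length xs)"
      using Cons.IH[OF False s k(1)] by blast
    then show ?thesis using k False by (intro exI[of _ j]) auto
  qed
qed simp

text \<open>Indices that differ by less than \<open>n\<close> are not congruent, so the arc repeats
  no vertex.\<close>

lemma cyc_enum_arc:
  assumes "cyc_enum G n c" and "k < n"
  shows "\<exists>xs. path_between G (c i) xs (c (i + int k)) \<and> length xs = Suc k"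
proof -
  define xs where "xs = map (\<lambda>t. c (i + int t)) [0..<Suc k]"
  have ce: "c i = c j \<longleftrightarrow> int n dvd (i - j)" for i j
    using assms by (simp add: cyc_enum_def mod_eq_dvd_iff)
  have "inj_on (\<lambda>t. c (i + int t)) {0..<Suc k}"
  proof (rule inj_onI)
    fix s t assume st: "s \<in> {0..<Suc k}" "t \<in> {0..<Suc k}" "c (i + int s) = c (i + int t)"
    then have "int n dvd (int s - int t)" by (simp add: ce)
    moreover have "\<bar>int s - int t\<bar> < int n" using st assms(2) by auto
    ultimately show "s = t" by (metis dvd_imp_le_int eq_iff_diff_eq_0 not_less abs_of_nat of_nat_eq_iff)
  qed
  then have "distinct xs" by (simp add: xs_def distinct_map del: upt_Suc)
  moreover have "set xs \<subseteq> verts G" using assms by (auto simp: xs_def cyc_enum_def)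
  moreover have "successively (\<lambda>u v. {u, v} \<in> edges G) xs"
  proof -
    have "{c (i + int t), c (i + (1 + int t))} \<in> edges G" for t
      using assms unfolding cyc_enum_def by (auto intro!: image_eqI[of _ _ "i + int t"] simp: algebra_simps)
    then show ?thesis
      by (auto simp: xs_def successively_conv_nth simp del: upt_Suc)
  qed
  moreover have "xs \<noteq> []" "length xs = Suc k" by (auto simp: xs_def)
  moreover from this have "hd xs = c i" "last xs = c (i + int k)"
    by (simp_all add: hd_conv_nth last_conv_nth) (simp_all add: xs_def del: upt_Suc)
  ultimately show ?thesis unfolding path_between_def is_path_def by blast
qed

lemma cyc_enum_gdist:
  assumes "cyc_enum G n c" and "k < n"
  shows "gdist G (c i) (c (i + int k)) = min k (n - k)"
proof -
  have ce: "c i = c j \<longleftrightarrow> int n dvd (i - j)" for i j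
    using assms by (simp add: cyc_enum_def mod_eq_dvd_iff)
  show ?thesis unfolding gdist_def
  proof (rule Least_equality)
    show "\<exists>xs. path_between G (c i) xs (c (i + int k)) \<and> length xs = Suc (min k (n - k))"
    proof (cases "k \<le> n - k")
      case True
      then show ?thesis using cyc_enum_arc[OF assms] by simp
    next
      case False
      \<comment> \<open>The other arc goes backwards from \<open>i\<close>, hence forwards in the
        reflected enumeration.\<close>
      have "\<exists>xs. path_between G (c (- (- i))) xs (c (- (- i + int (n - k)))) \<and>
              length xs = Suc (n - k)"
        using False assms by (intro cyc_enum_arc[OF cyc_enum_reflect]) auto
      moreover have "c (- (- i + int (n - k))) = c (i + int k)"
        using assms by (simp add: ce of_nat_diff)
      ultimately show ?thesis using False by simp
    qed
  next
    fix m assume "\<exists>xs. path_between G (c i) xs (c (i + int k)) \<and> length xs = Suc m"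
    then obtain xs where "xs \<noteq> []" "successively (\<lambda>u v. {u, v} \<in> edges G) xs" "hd xs = c i"
      "last xs = c (i + int k)" "length xs = Suc m"
      unfolding path_between_def is_path_def by blast
    then obtain j where j: "c (i + int k) = c j" "\<bar>j - i\<bar> \<le> int m"
      using cyc_enum_walk[OF assms(1), of xs i] by auto
    \<comment> \<open>\<open>t\<close> counts the rounds by which the lifted end falls short of
      \<open>i + int k\<close>: for \<open>t \<le> 0\<close> the walk covers at least
      \<open>k\<close> edges forwards, otherwise at least \<open>n - k\<close> backwards.\<close>
    then obtain t where t: "i + int k - j = int n * t" by (auto simp: ce)
    show "min k (n - k) \<le> m"
    proof (cases "t \<le> 0")
      case True
      then have "int n * t \<le> 0" by (simp add: mult_nonneg_nonpos)
      then show ?thesis using j t by linarith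
    next
      case False
      then have "int n * 1 \<le> int n * t" by (intro mult_left_mono) auto
      then show ?thesis using j t assms(2) by linarith
    qed
  qed
qed


subsection \<open>Sites on a line\<close>

text \<open>A position is a site if its priority is positive, smaller priorities winning ties. The cell of
  the site \<open>q\<close> consists of the positions \<open>y\<close> with \<open>bL q \<le> 2 * y < bR q\<close>.\<close>

definition nx :: "(nat \<Rightarrow> nat) \<Rightarrow> nat \<Rightarrow> nat" where
  "nx pr i = (LEAST j. i \<le> j \<and> 0 < pr j)"

definition prv :: "(nat \<Rightarrow> nat) \<Rightarrow> nat \<Rightarrow> nat" where
  "prv pr i = (GREATEST j. j < i \<and> 0 < pr j)"

text \<open>Twice the midpoint of \<open>q\<close> and the next site. The added 1 keeps an
  equidistant position on the side of \<open>q\<close> when \<open>q\<close> has priority.\<close>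

definition bR :: "nat \<Rightarrow> (nat \<Rightarrow> nat) \<Rightarrow> nat \<Rightarrow> nat" where
  "bR n pr q = (if q < n
     then q + nx pr (Suc q) + (if pr q < pr (nx pr (Suc q)) then 1 else 0) else 2 * n)"

definition bL :: "nat \<Rightarrow> (nat \<Rightarrow> nat) \<Rightarrow> nat \<Rightarrow> nat" where
  "bL n pr q = (if q = 0 then 0 else bR n pr (prv pr q))"

definition cyc_dist :: "nat \<Rightarrow> nat \<Rightarrow> nat \<Rightarrow> nat" where
  "cyc_dist n y q = (let k = (if q \<le> y then y - q else q - y) in min k (n - k))"

text \<open>The positions \<open>0\<close> and \<open>n\<close> are two copies of the site at which
  the cycle was cut, hence the equal priorities.\<close>

locale line =
  fixes n :: nat and pr :: "nat \<Rightarrow> nat"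
  assumes n_pos: "0 < n" and site_0: "0 < pr 0" and pr_n: "pr n = pr 0"
begin

lemma site_n: "0 < pr n" using site_0 pr_n by simp

lemma nx:
  assumes "i \<le> n"
  shows nx_ge: "i \<le> nx pr i" and nx_site: "0 < pr (nx pr i)" and nx_le: "nx pr i \<le> n"
    and nx_min: "\<And>j. i \<le> j \<Longrightarrow> 0 < pr j \<Longrightarrow> nx pr i \<le> j"
proof -
  have "i \<le> nx pr i \<and> 0 < pr (nx pr i)" unfolding nx_def
    by (rule LeastI[of _ n]) (use assms site_n in auto)
  then show "i \<le> nx pr i" "0 < pr (nx pr i)" by auto
  show m: "nx pr i \<le> j" if "i \<le> j" "0 < pr j" for j
    unfolding nx_def by (rule Least_le) (use that in auto)
  show "nx pr i \<le> n" using m[of n] assms site_n by auto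
qed

lemma nx_eqI: "\<lbrakk>i \<le> j; 0 < pr j; \<And>k. i \<le> k \<Longrightarrow> k < j \<Longrightarrow> pr k = 0\<rbrakk> \<Longrightarrow> nx pr i = j"
  unfolding nx_def by (rule Least_equality) (auto simp: not_less[symmetric])

lemma nx_self: "0 < pr i \<Longrightarrow> nx pr i = i"
  by (rule nx_eqI) auto

lemma nx_skip:
  assumes "i < n" "pr i = 0" shows "nx pr i = nx pr (Suc i)"
proof (rule nx_eqI)
  show "i \<le> nx pr (Suc i)" "0 < pr (nx pr (Suc i))" using nx[of "Suc i"] assms by auto
  show "pr k = 0" if "i \<le> k" "k < nx pr (Suc i)" for k
    using that nx_min[of "Suc i" k] assms by (cases "k = i") (auto simp: Suc_le_eq)
qed

lemma prv:
  assumes "0 < i"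
  shows prv_less: "prv pr i < i" and prv_site: "0 < pr (prv pr i)"
    and prv_max: "\<And>j. j < i \<Longrightarrow> 0 < pr j \<Longrightarrow> j \<le> prv pr i"
proof -
  have "prv pr i < i \<and> 0 < pr (prv pr i)" unfolding prv_def
    by (rule GreatestI_nat[of _ 0 i]) (use assms site_0 in auto)
  then show "prv pr i < i" "0 < pr (prv pr i)" by auto
  show "j \<le> prv pr i" if "j < i" "0 < pr j" for j
    unfolding prv_def by (rule Greatest_le_nat[of _ j i]) (use that in auto)
qed

lemma prv_eqI: "\<lbrakk>j < i; 0 < pr j; \<And>k. j < k \<Longrightarrow> k < i \<Longrightarrow> pr k = 0\<rbrakk> \<Longrightarrow> prv pr i = j"
  unfolding prv_def by (rule Greatest_equality) (auto simp: not_less[symmetric])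

lemma prv_nx: "\<lbrakk>q < n; 0 < pr q\<rbrakk> \<Longrightarrow> prv pr (nx pr (Suc q)) = q"
  using nx[of "Suc q"] by (intro prv_eqI) (auto simp: Suc_le_eq dest!: leD)

lemma nx_prv: "\<lbrakk>0 < q; 0 < pr q\<rbrakk> \<Longrightarrow> nx pr (Suc (prv pr q)) = q"
  using prv[of q] by (intro nx_eqI) (auto simp: Suc_le_eq dest!: leD)

lemma bL_nx: "\<lbrakk>q < n; 0 < pr q\<rbrakk> \<Longrightarrow> bL n pr (nx pr (Suc q)) = bR n pr q"
  using nx[of "Suc q"] by (auto simp: bL_def prv_nx)

lemma bR_bounds:
  assumes "q \<le> n" "0 < pr q" shows "2 * q \<le> bR n pr q" "bR n pr q \<le> 2 * n" "q < n \<Longrightarrow> 2 * q < bR n pr q"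
  using nx[of "Suc q"] assms by (auto simp: bR_def)

lemma bR_le_nx:
  assumes "q < n" "0 < pr q" shows "bR n pr q \<le> 2 * nx pr (Suc q)"
  using nx[of "Suc q"] assms by (auto simp: bR_def)

lemma bL_bounds:
  assumes "q \<le> n" "0 < pr q" shows "bL n pr q \<le> 2 * q"
  using assms bR_le_nx[of "prv pr q"] prv[of q] nx_prv[of q] by (auto simp: bL_def)

lemma bL_le_bR: "\<lbrakk>q \<le> n; 0 < pr q\<rbrakk> \<Longrightarrow> bL n pr q \<le> bR n pr q"
  using bL_bounds bR_bounds order_trans by blast

text \<open>The boundary between the last site at or before \<open>y\<close> and the site after it
  decides which of the two owns \<open>y\<close>.\<close>

lemma cell_exists:
  assumes "y < n"
  obtains q where "q \<le> n" "0 < pr q" "bL n pr q \<le> 2 * y" "2 * y < bR n pr q"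
proof -
  define l where "l = prv pr (Suc y)"
  have l: "l \<le> y" "0 < pr l" using prv[of "Suc y"] by (auto simp: l_def)
  define r where "r = nx pr (Suc l)"
  have r: "l < r" "r \<le> n" "0 < pr r" "bL n pr r = bR n pr l"
    using nx[of "Suc l"] l assms bL_nx[of l] by (auto simp: r_def)
  have yr: "y < r"
  proof (rule ccontr)
    assume "\<not> y < r"
    then have "r \<le> l" using prv_max[of "Suc y" r] r by (auto simp: l_def)
    then show False using r by simp
  qed
  show thesis
  proof (cases "2 * y < bR n pr l")
    case True
    then show ?thesis using that[of l] l bL_bounds[of l] assms by auto
  next
    case False
    then show ?thesis using that[of r] r bR_bounds(1)[of r] yr by auto
  qed
qed

text \<open>A site of the cycle is a site of the line modulo \<open>n\<close>.\<close>

lemma cell_nearest: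
  assumes inj: "\<And>p q. p < n \<Longrightarrow> q < n \<Longrightarrow> 0 < pr p \<Longrightarrow> pr p = pr q \<Longrightarrow> p = q"
    and y: "y < n" and q: "q \<le> n" "0 < pr q" "bL n pr q \<le> 2 * y" "2 * y < bR n pr q"
    and s: "s < n" "0 < pr s" "s \<noteq> q mod n"
  shows "cyc_dist n y (q mod n) < cyc_dist n y s \<or>
    cyc_dist n y (q mod n) = cyc_dist n y s \<and> pr (q mod n) < pr s"
proof (cases "q \<le> y")
  case True
  then have qn: "q < n" "q mod n = q" using y by auto
  define r where "r = nx pr (Suc q)"
  have r: "q < r" "r \<le> n" "0 < pr r" using nx[of "Suc q"] qn by (auto simp: r_def)
  have sr: "s < q \<or> r \<le> s" using nx_min[of "Suc q" s] s qn by (cases "s < q") (auto simp: r_def)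
  have yb: "2 * y < q + r + (if pr q < pr r then 1 else 0)"
    using q qn by (simp add: bR_def r_def)
  then have yr: "y - q \<le> r - y" "y < r" using r True by (auto split: if_splits)
  \<comment> \<open>At equal distance the strict inequality \<open>yb\<close> can only come from the
    added 1.\<close>
  have tie: "pr q < pr r" if "y - q = r - y" using that yb yr r True by (auto split: if_splits)
  have d: "cyc_dist n y (q mod n) \<le> y - q" using True qn by (auto simp: cyc_dist_def Let_def)
  show ?thesis
  proof (cases "s < q")
    case sq: True
    have "y - q < y - s" "r - y \<le> n - (y - s)" using sq True y r by auto
    \<comment> \<open>Going forward across the cut reaches \<open>s\<close> no sooner than
      \<open>r\<close>. Equality makes them the two copies of the first site, so the tie with
      \<open>r\<close> settles the tie with \<open>s\<close>.\<close>
    moreover have "r = n \<and> s = 0" if "r - y = n - (y - s)"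
      using that sq True y r by auto
    ultimately have "y - q < n - (y - s) \<or> y - q = n - (y - s) \<and> pr q < pr s"
      using yr tie pr_n by fastforce
    moreover have "cyc_dist n y s = min (y - s) (n - (y - s))"
      using sq True by (simp add: cyc_dist_def)
    ultimately show ?thesis using d qn \<open>y - q < y - s\<close> by auto
  next
    case False
    then have "r \<le> s" using sr by simp
    then have "y - q < n - (s - y)" "y - q < s - y \<or> y - q = s - y \<and> s = r"
      using yr y s r by auto
    moreover have "cyc_dist n y s = min (s - y) (n - (s - y))"
      using yr \<open>r \<le> s\<close> by (simp add: cyc_dist_def)
    ultimately show ?thesis using d qn tie yr \<open>r \<le> s\<close> by auto
  qed
next
  case False
  define l where "l = prv pr q"
  have l: "l < q" "0 < pr l" using prv[of q] False by (auto simp: l_def)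
  have nl: "nx pr (Suc l) = q" using nx_prv False q by (simp add: l_def)
  have sl: "s \<le> l \<or> q \<le> s" using prv_max[of q s] s False by (auto simp: l_def)
  have yb: "l + q + (if pr l < pr q then 1 else 0) \<le> 2 * y"
    using q l False nl by (simp add: bL_def bR_def flip: l_def)
  have prq: "pr (q mod n) = pr q" using pr_n q by (cases "q = n") auto
  have d: "cyc_dist n y (q mod n) \<le> q - y"
    using False q y by (cases "q = n") (auto simp: cyc_dist_def)
  have lq: "q - y \<le> y - l" "l < y" using yb l False by (auto split: if_splits)
  \<comment> \<open>Consecutive sites share a priority only as the two copies \<open>0\<close> and
    \<open>n\<close>; the injectivity assumption speaks of positions below \<open>n\<close>, hence
    the reduction of \<open>q\<close>.\<close>
  have ne: "pr l \<noteq> pr q" if "l \<noteq> q mod n"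
    using inj[of l "q mod n"] that l q prq n_pos by auto
  show ?thesis
  proof (cases "s \<le> l")
    case True
    have "y - l \<le> y - s" "q - y \<le> n - (y - s)" using True q y lq by auto
    moreover have "q = n \<and> s = 0" if "q - y = n - (y - s)"
      using that True q y lq by auto
    moreover have "q \<noteq> n \<or> s \<noteq> 0" using s by auto
    ultimately have A: "q - y < n - (y - s)" by linarith
    have B: "q - y < y - s \<or> q - y = y - s \<and> pr q < pr s"
    proof (cases "s = l")
      case sl: True
      show ?thesis
      proof (cases "pr l < pr q")
        case True
        then show ?thesis using yb sl \<open>\<not> q \<le> y\<close> by auto
      next
        case False
        then have "pr q < pr l" using ne s sl by auto
        then show ?thesis using sl lq by auto
      qed
    next
      case False
      then show ?thesis using True lq by auto
    qed
    have "cyc_dist n y s = min (y - s) (n - (y - s))" using True lq by (simp add: cyc_dist_def)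
    then show ?thesis using A B d prq by linarith
  next
    case F: False
    then have "q \<le> s" using sl by simp
    moreover have "q \<noteq> s" using s(1,3) by auto
    ultimately have "q - y < s - y" "q - y < n - (s - y)" "y \<le> s" using lq s(1) False by linarith+
    then have "q - y < cyc_dist n y s" by (auto simp: cyc_dist_def Let_def)
    then show ?thesis using d by simp
  qed
qed

end

section \<open>Prefix sums of the costs over doubled positions\<close>

definition psum :: "nat \<Rightarrow> (nat \<Rightarrow> real) \<Rightarrow> nat \<Rightarrow> real" where
  "psum n w j = (\<Sum>y | y < n \<and> 2 * y < j. w y)"

lemma psum_0 [simp]: "psum n w 0 = 0"
  by (simp add: psum_def)

text \<open>Together with \<open>psum_even\<close> this is the recurrence by which the walk extends
  the table: the cost at \<open>i\<close> counts from index \<open>2 * i + 1\<close> on.\<close>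

lemma psum_odd:
  assumes "i < n" shows "psum n w (2 * i + 1) = psum n w (2 * i) + w i"
proof -
  have "{y. y < n \<and> 2 * y < 2 * i + 1} = insert i {y. y < n \<and> 2 * y < 2 * i}"
    using assms by auto
  then show ?thesis by (simp add: psum_def add.commute)
qed

lemma psum_even: "psum n w (2 * i + 2) = psum n w (2 * i + 1)"
  unfolding psum_def by (rule sum.cong) (auto, presburger)

lemma psum_diff:
  assumes "a \<le> b" shows "psum n w b - psum n w a = (\<Sum>y | y < n \<and> a \<le> 2 * y \<and> 2 * y < b. w y)"
proof -
  have "{y. y < n \<and> 2 * y < b} = {y. y < n \<and> 2 * y < a} \<union> {y. y < n \<and> a \<le> 2 * y \<and> 2 * y < b}"
    using assms by auto
  then show ?thesis by (simp add: psum_def sum.union_disjoint disjoint_iff)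
qed

lemma psum_mono: "\<lbrakk>\<And>y. y < n \<Longrightarrow> 0 \<le> w y; a \<le> b\<rbrakk> \<Longrightarrow> psum n w a \<le> psum n w b"
  unfolding psum_def by (rule sum_mono2) auto

text \<open>A full load at an inner site; the pieces of \<open>0\<close> and \<open>n\<close> form
  one load together.\<close>

definition piece :: "nat \<Rightarrow> (nat \<Rightarrow> real) \<Rightarrow> (nat \<Rightarrow> nat) \<Rightarrow> nat \<Rightarrow> real" where
  "piece n w pr q = psum n w (bR n pr q) - psum n w (bL n pr q)"

lemma (in line) piece_eq:
  assumes "q \<le> n" "0 < pr q"
  shows "piece n w pr q = (\<Sum>y | y < n \<and> bL n pr q \<le> 2 * y \<and> 2 * y < bR n pr q. w y)"
  unfolding piece_def using psum_diff bL_le_bR[OF assms] .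


subsection \<open>Territories and loads on a cycle\<close>

text \<open>The successor reserves 0 for vertices outside the list, which agrees with the initial
  content of the memory.\<close>

definition prio :: "'a list \<Rightarrow> 'a \<Rightarrow> nat" where
  "prio S v = (if v \<in> set S then Suc (LEAST k. k < length S \<and> S ! k = v) else 0)"

lemma prio_nth:
  assumes "distinct S" "k < length S" shows "prio S (S ! k) = Suc k"
proof -
  have "(LEAST j. j < length S \<and> S ! j = S ! k) = k"
    using assms by (intro Least_equality) (auto simp: nth_eq_iff_index_eq)
  then show ?thesis using assms by (simp add: prio_def)
qed

lemma prio_pos_iff: "0 < prio S v \<longleftrightarrow> v \<in> set S"
  by (simp add: prio_def)

lemma prio_le:
  assumes "distinct S" shows "prio S v \<le> length S"
proof (cases "v \<in> set S")
  case True
  then obtain k where "k < length S" "S ! k = v" by (auto simp: in_set_conv_nth)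
  then show ?thesis using prio_nth[OF assms, of k] by simp
qed (simp add: prio_def)

lemma prio_snoc:
  assumes "distinct S" "u \<notin> set S"
  shows "prio (S @ [u]) v = (if v = u then Suc (length S) else prio S v)"
proof -
  have d: "distinct (S @ [u])" using assms by simp
  show ?thesis
  proof (cases "v \<in> set S")
    case True
    then obtain k where k: "k < length S" "S ! k = v" by (auto simp: in_set_conv_nth)
    then show ?thesis
      using prio_nth[OF d, of k] prio_nth[OF assms(1), of k] assms by (auto simp: nth_append)
  next
    case False
    then show ?thesis
      using prio_nth[OF d, of "length S"] by (auto simp: prio_def)
  qed
qed

text \<open>Replaces the minimum by pairwise lexicographic comparisons of distance and index, the
  form that \<open>cell_nearest\<close> delivers.\<close>

lemma territory_iff:
  assumes "k < length S" "v \<in> verts G"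
  shows "v \<in> territory G S k \<longleftrightarrow> (\<forall>j < length S. j \<noteq> k \<longrightarrow> gdist G v (S ! k) < gdist G v (S ! j) \<or>
    gdist G v (S ! k) = gdist G v (S ! j) \<and> k < j)"
proof -
  define d where "d j = gdist G v (S ! j)" for j
  define m where "m = gdist_list G v S"
  have m: "m = Min (d ` {..<length S})"
  proof -
    have "gdist G v ` set S = d ` {..<length S}"
      by (auto simp: set_conv_nth d_def)
    then show ?thesis by (simp add: m_def gdist_list_def)
  qed
  have ne: "d ` {..<length S} \<noteq> {}" using assms by auto
  have le: "m \<le> d j" if "j < length S" for j using that m by simp
  have at: "\<exists>j < length S. d j = m" using Min_in[OF _ ne] m by auto
  have "v \<in> territory G S k \<longleftrightarrow> d k = m \<and> (\<forall>j<k. m < d j)"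
    using assms by (simp add: territory_def d_def m_def)
  also have "\<dots> \<longleftrightarrow> (\<forall>j < length S. j \<noteq> k \<longrightarrow> d k < d j \<or> d k = d j \<and> k < j)"
  proof (intro iffI conjI allI impI)
    fix j assume A: "d k = m \<and> (\<forall>j<k. m < d j)" "j < length S" "j \<noteq> k"
    have "m < d j" if "\<not> k < j" using A that by auto
    then show "d k < d j \<or> d k = d j \<and> k < j" using le[OF A(2)] A(1) by linarith
  next
    assume *: "\<forall>j < length S. j \<noteq> k \<longrightarrow> d k < d j \<or> d k = d j \<and> k < j"
    obtain j where "j < length S" "d j = m" using at by auto
    then show "d k = m" using * le[of k] assms(1) by (cases "j = k") auto
  next
    fix j assume *: "\<forall>j < length S. j \<noteq> k \<longrightarrow> d k < d j \<or> d k = d j \<and> k < j" and "j < k"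
    then have "d k < d j" using spec[OF *, of j] assms(1) by auto
    then show "m < d j" using le[OF assms(1)] by simp
  qed
  finally show ?thesis by (simp add: d_def)
qed

lemma territory_disjoint:
  assumes "v \<in> territory G S j" "v \<in> territory G S k" shows "j = k"
proof (rule linorder_cases[of j k])
  assume "j < k"
  then show ?thesis using assms by (auto simp: territory_def)
next
  assume "k < j"
  then show ?thesis using assms by (auto simp: territory_def)
qed

lemma cyc_enum_gdist_nat:
  assumes c: "cyc_enum G n c" and "y < n" "q < n"
  shows "gdist G (c (int y)) (c (int q)) = cyc_dist n y q"
proof (cases "q < y")
  case True
  \<comment> \<open>\<open>cyc_enum_gdist\<close> counts forward from \<open>y\<close>, so a smaller
    \<open>q\<close> is reached by going round.\<close>
  have "c (int y + int (n - (y - q))) = c (int q)"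
    using c True assms by (simp add: cyc_enum_def mod_eq_dvd_iff of_nat_diff)
  then show ?thesis
    using cyc_enum_gdist[OF c, of "n - (y - q)" "int y"] True assms
    by (simp add: cyc_dist_def Let_def min.commute)
next
  case False
  then show ?thesis
    using cyc_enum_gdist[OF c, of "q - y" "int y"] assms
    by (auto simp: cyc_dist_def Let_def of_nat_diff)
qed

lemma cyc_enum_eq_nat:
  assumes "cyc_enum G n c" "i < n" "j < n" shows "c (int i) = c (int j) \<longleftrightarrow> i = j"
  using assms by (simp add: cyc_enum_def)

lemma cyc_enum_n: "cyc_enum G n c \<Longrightarrow> c (int n) = c 0"
  by (simp add: cyc_enum_def)

lemma cyc_enum_verts:
  assumes "cyc_enum G n c" shows "verts G = (\<lambda>i. c (int i)) ` {..<n}"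
proof -
  have "c i \<in> (\<lambda>i. c (int i)) ` {..<n}" for i
  proof (rule image_eqI)
    show "c i = c (int (nat (i mod int n)))" "nat (i mod int n) \<in> {..<n}"
      using assms by (auto simp: cyc_enum_def nat_less_iff)
  qed
  then have "range c \<subseteq> (\<lambda>i. c (int i)) ` {..<n}" by (rule image_subsetI)
  moreover have "verts G = range c" using assms by (simp add: cyc_enum_def)
  ultimately show ?thesis by auto
qed

lemma line_prio:
  assumes "cyc_enum G n c" "c 0 \<in> set S"
  shows "line n (\<lambda>i. prio S (c (int i)))"
proof
  show "0 < n" using assms by (simp add: cyc_enum_def)
qed (use assms in \<open>simp_all add: prio_pos_iff cyc_enum_n[OF assms(1)]\<close>)

text \<open>Reading \<open>q\<close> modulo \<open>n\<close> covers both copies of the first site.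
  Distinctness of \<open>S\<close> supplies the injectivity of priorities that
  \<open>cell_nearest\<close> asks for.\<close>

lemma cell_territory:
  assumes c: "cyc_enum G n c" and S: "distinct S" "set S \<subseteq> verts G" "c 0 \<in> set S"
    and pr: "pr = (\<lambda>i. prio S (c (int i)))"
    and k: "k < length S" "S ! k = c (int (q mod n))"
    and y: "y < n" and q: "q \<le> n" "bL n pr q \<le> 2 * y" "2 * y < bR n pr q"
  shows "c (int y) \<in> territory G S k"
proof -
  interpret line n pr unfolding pr by (rule line_prio[OF c S(3)])
  have inj: "p = q" if pq: "p < n" "q < n" "0 < pr p" "pr p = pr q" for p q
  proof -
    obtain a b where ab: "a < length S" "S ! a = c (int p)" "b < length S" "S ! b = c (int q)"
      using pq(3,4) unfolding pr by (metis in_set_conv_nth prio_pos_iff)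
    then have "prio S (c (int p)) = Suc a" "prio S (c (int q)) = Suc b"
      using prio_nth[OF S(1)] by metis+
    then have "c (int p) = c (int q)" using pq(4) ab by (simp add: pr)
    then show ?thesis using cyc_enum_eq_nat[OF c pq(1,2)] by simp
  qed
  have prk: "pr (q mod n) = Suc k" using prio_nth[OF S(1) k(1)] k by (simp add: pr)
  have prq: "0 < pr q" using prk pr_n q(1) by (cases "q = n") auto
  have cy: "c (int y) \<in> verts G" using cyc_enum_verts[OF c] y by auto
  show ?thesis unfolding territory_iff[OF k(1) cy]
  proof (intro allI impI)
    fix j assume j: "j < length S" "j \<noteq> k"
    have "S ! j \<in> verts G" using S(2) j by auto
    then obtain p where p: "p < n" "S ! j = c (int p)" using cyc_enum_verts[OF c] by auto
    have prp: "pr p = Suc j" using prio_nth[OF S(1) j(1)] p by (simp add: pr)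
    then have "p \<noteq> q mod n" using prk j by auto
    then have "cyc_dist n y (q mod n) < cyc_dist n y p \<or>
        cyc_dist n y (q mod n) = cyc_dist n y p \<and> pr (q mod n) < pr p"
      using cell_nearest[OF inj y q(1) prq q(2,3), of p] p prp by auto
    then show "gdist G (c (int y)) (S ! k) < gdist G (c (int y)) (S ! j) \<or>
      gdist G (c (int y)) (S ! k) = gdist G (c (int y)) (S ! j) \<and> k < j"
      using cyc_enum_gdist_nat[OF c y] p(1) n_pos unfolding k p(2) by (simp add: prk prp)
  qed
qed

text \<open>Each cell lies in the territory of its site. Cells cover the line and territories are
  disjoint, so nothing else lies there; the first site collects two cells.\<close>

lemma load_piece:
  assumes c: "cyc_enum G n c" and S: "distinct S" "set S \<subseteq> verts G" "c 0 \<in> set S"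
    and pr: "pr = (\<lambda>i. prio S (c (int i)))" and w: "w = (\<lambda>i. \<pi> (c (int i)))"
    and k: "k < length S" "S ! k = c (int q)" "q < n"
  shows "load G \<pi> S k = (if q = 0 then piece n w pr 0 + piece n w pr n else piece n w pr q)"
proof -
  interpret line n pr unfolding pr by (rule line_prio[OF c S(3)])
  define Y where "Y q = {y. y < n \<and> bL n pr q \<le> 2 * y \<and> 2 * y < bR n pr q}" for q
  have prq: "0 < pr q" using prio_nth[OF S(1) k(1)] k by (simp add: pr)
  have T: "c (int y) \<in> territory G S k \<longleftrightarrow> y \<in> Y q \<or> q = 0 \<and> y \<in> Y n" if y: "y < n" for y
  proof
    assume T: "c (int y) \<in> territory G S k"
    obtain p where p: "p \<le> n" "0 < pr p" "bL n pr p \<le> 2 * y" "2 * y < bR n pr p"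
      using cell_exists[OF y] by auto
    have "0 < pr (p mod n)" using p pr_n by (cases "p = n") auto
    then obtain j where j: "j < length S" "S ! j = c (int (p mod n))"
      by (auto simp: pr prio_pos_iff in_set_conv_nth)
    have "j = k" using cell_territory[OF c S pr j y p(1,3,4)] T by (rule territory_disjoint)
    then have "c (int q) = c (int (p mod n))" using j k by simp
    then have "q = p mod n" using cyc_enum_eq_nat[OF c k(3)] n_pos by simp
    then show "y \<in> Y q \<or> q = 0 \<and> y \<in> Y n"
      using p y by (cases "p = n") (auto simp: Y_def)
  next
    assume "y \<in> Y q \<or> q = 0 \<and> y \<in> Y n"
    then show "c (int y) \<in> territory G S k"
      using cell_territory[OF c S pr k(1), of q y] cell_territory[OF c S pr k(1), of n y] k
      by (auto simp: Y_def)
  qed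
  have "territory G S k = (\<lambda>y. c (int y)) ` {y. y < n \<and> (y \<in> Y q \<or> q = 0 \<and> y \<in> Y n)}"
    using T cyc_enum_verts[OF c] by (auto simp: territory_def)
  moreover have "inj_on (\<lambda>y. c (int y)) {y. y < n \<and> (y \<in> Y q \<or> q = 0 \<and> y \<in> Y n)}"
    using cyc_enum_eq_nat[OF c] by (auto simp: inj_on_def)
  ultimately have L: "load G \<pi> S k = sum w {y. y < n \<and> (y \<in> Y q \<or> q = 0 \<and> y \<in> Y n)}"
    by (simp add: load_def sum.reindex w)
  have P: "piece n w pr p = sum w (Y p)" if "p \<le> n" "0 < pr p" for p
    using piece_eq[OF that] by (simp add: Y_def)
  show ?thesis
  proof (cases "q = 0")
    case True
    \<comment> \<open>With a single site the two end cells meet at a common boundary; otherwise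
      another site separates them.\<close>
    have disj: "Y 0 \<inter> Y n = {}"
    proof -
      have "bR n pr 0 \<le> bL n pr n"
      proof (cases "prv pr n = 0")
        case True
        then show ?thesis using n_pos by (simp add: bL_def)
      next
        case False
        then have "nx pr (Suc 0) \<le> prv pr n" using nx_min[of "Suc 0" "prv pr n"] prv[OF n_pos] n_pos by auto
        then show ?thesis using bR_le_nx[OF n_pos site_0] bR_bounds(1)[of "prv pr n"] prv[OF n_pos] n_pos
          by (simp add: bL_def)
      qed
      then show ?thesis by (auto simp: Y_def)
    qed
    have "{y. y < n \<and> (y \<in> Y q \<or> q = 0 \<and> y \<in> Y n)} = Y 0 \<union> Y n" using True by (auto simp: Y_def)
    then have "load G \<pi> S k = sum w (Y 0) + sum w (Y n)"
      unfolding L using disj by (simp add: sum.union_disjoint Y_def)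
    then show ?thesis using P[of 0] P[of n] site_0 site_n True by simp
  next
    case False
    then have "{y. y < n \<and> (y \<in> Y q \<or> q = 0 \<and> y \<in> Y n)} = Y q" by (auto simp: Y_def)
    then show ?thesis using False L P[of q] prq k by simp
  qed
qed


subsection \<open>The load after adding a vertex\<close>

text \<open>A site of lowest priority loses its ties on both sides, so only its boundary with
  \<open>l\<close> receives the added 1. The gap from \<open>l\<close> to \<open>r\<close> is the
  only one that is split, and the other boundaries stay.\<close>

lemma (in line) insert_site:
  assumes x: "x < n" "pr x = 0"
    and pr': "\<And>i. i \<le> n \<Longrightarrow> pr' i = (if i = x then P else pr i)" and P: "\<And>i. i \<le> n \<Longrightarrow> pr i < P"
    and l: "l = prv pr x" and r: "r = nx pr (Suc x)"
  shows "line n pr'" "l < x" "x < r" "r \<le> n" "0 < pr l" "0 < pr r" "nx pr (Suc l) = r"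
    "\<And>q. q \<le> n \<Longrightarrow> 0 < pr q \<Longrightarrow> q \<le> l \<or> r \<le> q"
    "bR n pr' l = x + l + 1" "bR n pr' x = x + r"
    "\<And>q. q \<le> n \<Longrightarrow> 0 < pr q \<Longrightarrow> q \<noteq> l \<Longrightarrow> bR n pr' q = bR n pr q"
    "bL n pr' x = x + l + 1" "bL n pr' r = x + r"
    "\<And>q. q \<le> n \<Longrightarrow> 0 < pr q \<Longrightarrow> q \<noteq> r \<Longrightarrow> bL n pr' q = bL n pr q"
proof -
  have x0: "0 < x" using x site_0 by (cases x) auto
  show l1: "l < x" "0 < pr l" using prv[OF x0] by (auto simp: l)
  show r1: "x < r" "r \<le> n" "0 < pr r" using nx[of "Suc x"] x by (auto simp: r)
  show gap: "q \<le> l \<or> r \<le> q" if "q \<le> n" "0 < pr q" for q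
    using prv_max[OF x0, of q] nx_min[of "Suc x" q] that x by (cases "q < x"; cases "q = x") (auto simp: l r)
  show nl: "nx pr (Suc l) = r"
  proof (rule nx_eqI)
    show "pr k = 0" if "Suc l \<le> k" "k < r" for k using gap[of k] that r1 by auto
  qed (use l1 r1 in auto)
  show L: "line n pr'"
    using x0 x n_pos site_0 pr_n pr'[of 0] pr'[of n] by unfold_locales auto
  interpret L: line n pr' by (rule L)
  have eq: "pr' i = pr i" if "i \<le> n" "i \<noteq> x" for i using pr'[of i] that by simp
  have pos: "0 < pr' i \<longleftrightarrow> i = x \<or> 0 < pr i" if "i \<le> n" for i using pr'[of i] P[of i] that by auto
  have nxl: "nx pr' (Suc l) = x"
  proof (rule L.nx_eqI)
    show "pr' k = 0" if "Suc l \<le> k" "k < x" for k using gap[of k] pr'[of k] that r1 x by auto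
  qed (use l1 x pos[of x] in auto)
  have nxx: "nx pr' (Suc x) = r"
  proof (rule L.nx_eqI)
    show "pr' k = 0" if "Suc x \<le> k" "k < r" for k using gap[of k] pr'[of k] that r1 l1 by auto
  qed (use r1 eq[of r] in auto)
  have nxq: "nx pr' (Suc q) = nx pr (Suc q)" if q: "q < n" "0 < pr q" "q \<noteq> l" for q
  proof (rule L.nx_eqI)
    note n = nx[of "Suc q"]
    have "nx pr (Suc q) \<noteq> x" using n(2) q x by auto
    then show "0 < pr' (nx pr (Suc q))" using n q eq[of "nx pr (Suc q)"] by auto
    show "Suc q \<le> nx pr (Suc q)" using n q by auto
    show "pr' k = 0" if k: "Suc q \<le> k" "k < nx pr (Suc q)" for k
    proof -
      have kn: "k \<le> n" using k n(3) q by auto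
      have k0: "pr k = 0" using n(4)[of k] k q by auto
      \<comment> \<open>A gap that contains \<open>x\<close> can only start at
        \<open>l\<close>.\<close>
      have "k \<noteq> x"
      proof
        assume "k = x"
        then have "q < l" using gap[of q] k q r1 by auto
        then show False using n(4)[of l] q l1 k \<open>k = x\<close> by auto
      qed
      then show ?thesis using eq[OF kn] k0 by simp
    qed
  qed
  show bl: "bR n pr' l = x + l + 1" using l1 x eq[of l] pr'[of x] P[of l] by (auto simp: bR_def nxl)
  show bx: "bR n pr' x = x + r"
    using x r1 eq[of r] pr'[of x] P[of r] by (auto simp: bR_def nxx)
  show bq: "bR n pr' q = bR n pr q" if q: "q \<le> n" "0 < pr q" "q \<noteq> l" for q
  proof (cases "q = n")
    case False
    then have "q < n" using q by simp
    have "nx pr (Suc q) \<noteq> x" "nx pr (Suc q) \<le> n" using nx[of "Suc q"] \<open>q < n\<close> x by auto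
    moreover have "q \<noteq> x" using q x by auto
    ultimately show ?thesis using eq q \<open>q < n\<close> by (simp add: bR_def nxq)
  qed (simp add: bR_def)
  show "bL n pr' x = x + l + 1" using L.bL_nx[of l] l1 x eq[of l] bl by (simp add: nxl)
  show "bL n pr' r = x + r" using L.bL_nx[of x] x bx pos[of x] by (simp add: nxx)
  show "bL n pr' q = bL n pr q" if q: "q \<le> n" "0 < pr q" "q \<noteq> r" for q
  proof (cases "q = 0")
    case False
    define p where "p = prv pr q"
    have p: "p < q" "0 < pr p" "nx pr (Suc p) = q" using prv[of q] nx_prv[of q] False q by (auto simp: p_def)
    have "p \<noteq> l" using nl p q by auto
    moreover have "p \<noteq> x" using p x by auto
    ultimately have "bL n pr' q = bR n pr' p"
      using L.bL_nx[of p] nxq[of p] eq[of p] p q by simp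
    also have "\<dots> = bR n pr p" using bq[of p] p q \<open>p \<noteq> l\<close> by simp
    finally show ?thesis using False by (simp add: bL_def p_def)
  qed (simp add: bL_def)
qed

text \<open>The 0 makes the maximum meaningful when no site lies on this side and is harmless for
  nonnegative costs.\<close>

definition left_max :: "nat \<Rightarrow> (nat \<Rightarrow> real) \<Rightarrow> (nat \<Rightarrow> nat) \<Rightarrow> nat \<Rightarrow> real" where
  "left_max n w pr l = Max (insert 0 (piece n w pr ` {q. q < l \<and> 0 < pr q}))"

definition right_max :: "nat \<Rightarrow> (nat \<Rightarrow> real) \<Rightarrow> (nat \<Rightarrow> nat) \<Rightarrow> nat \<Rightarrow> real" where
  "right_max n w pr r = Max (insert 0 (piece n w pr ` {q. r < q \<and> q \<le> n \<and> 0 < pr q}))"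

text \<open>The terms are the cell of \<open>x\<close>, the untouched sites on either side, the
  shrunken cells of \<open>l\<close> and \<open>r\<close>, and the load of the first site, whose two
  pieces simplify because the table starts with 0. The maxima are nested in the order in which the
  program takes them.\<close>

definition new_load :: "nat \<Rightarrow> (nat \<Rightarrow> real) \<Rightarrow> (nat \<Rightarrow> nat) \<Rightarrow> nat \<Rightarrow> real" where
  "new_load n w pr x =
    (let l = prv pr x; r = nx pr (Suc x); W = psum n w; u = W (x + l + 1); v = W (x + r)
     in max (max (max (max (max (v - u) (left_max n w pr l)) (right_max n w pr r))
       (u - W (bL n pr l))) (W (bR n pr r) - v))
       (W (2 * n) + (if l \<le> 0 then u else W (bR n pr 0)) - (if n \<le> r then v else W (bL n pr n))))"

lemma max_load_le_iff:
  assumes "S \<noteq> []" shows "max_load G \<pi> S \<le> z \<longleftrightarrow> (\<forall>k < length S. load G \<pi> S k \<le> z)"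
  unfolding max_load_def using assms by (subst Max_le_iff) auto

text \<open>Both sides are shown to have the same upper bounds \<open>z\<close>, which avoids
  manipulating maxima over different index sets.\<close>

lemma max_load_snoc:
  assumes c: "cyc_enum G n c" and S: "distinct S" "set S \<subseteq> verts G" "c 0 \<in> set S"
    and pr: "pr = (\<lambda>i. prio S (c (int i)))" and w: "w = (\<lambda>i. \<pi> (c (int i)))"
    and nonneg: "\<And>v. v \<in> verts G \<Longrightarrow> 0 \<le> \<pi> v"
    and x: "x < n" "pr x = 0"
  shows "max_load G \<pi> (S @ [c (int x)]) = new_load n w pr x"
proof -
  interpret line n pr unfolding pr by (rule line_prio[OF c S(3)])
  let ?S = "S @ [c (int x)]"
  define pr' where "pr' = (\<lambda>i. prio ?S (c (int i)))"
  define l where "l = prv pr x"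
  define r where "r = nx pr (Suc x)"
  have cx: "c (int x) \<notin> set S" using x(2) prio_pos_iff[of S "c (int x)"] by (simp add: pr)
  have cxv: "c (int x) \<in> verts G" using cyc_enum_verts[OF c] x by auto
  have S': "distinct ?S" "set ?S \<subseteq> verts G" "c 0 \<in> set ?S" using S cx cxv by auto
  have x0: "0 < x" using x site_0 by (cases x) auto
  have ceq: "c (int i) = c (int x) \<longleftrightarrow> i = x" if "i \<le> n" for i
  proof (cases "i = n")
    case True
    then show ?thesis using cyc_enum_eq_nat[OF c, of 0 x] cyc_enum_n[OF c] x x0 by auto
  qed (use that x cyc_enum_eq_nat[OF c, of i x] in auto)
  have pr': "pr' i = (if i = x then Suc (length S) else pr i)" if "i \<le> n" for i
    using ceq[OF that] by (simp add: pr'_def prio_snoc[OF S(1) cx] pr)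
  have lt: "pr i < Suc (length S)" for i using prio_le[OF S(1)] by (simp add: pr less_Suc_eq_le)
  note ins = insert_site[OF x pr' lt l_def r_def]
  interpret L: line n pr' by (rule ins(1))
  define W where "W = psum n w"
  have mono: "W a \<le> W b" if "a \<le> b" for a b
    unfolding W_def using that nonneg cyc_enum_verts[OF c] by (intro psum_mono) (auto simp: w)
  have W0: "W 0 = 0" by (simp add: W_def)
  define t where "t = W (2 * n) + (if l \<le> 0 then W (x + l + 1) else W (bR n pr 0))
     - (if n \<le> r then W (x + r) else W (bL n pr n))"
  have pos: "0 < pr' i \<longleftrightarrow> i = x \<or> 0 < pr i" if "i \<le> n" for i using pr'[OF that] by auto
  have pL: "piece n w pr' l = W (x + l + 1) - W (bL n pr l)"
    using ins(2-9) ins(14)[of l] x by (simp add: piece_def W_def)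
  have pR: "piece n w pr' r = W (bR n pr r) - W (x + r)"
    using ins(2-8) ins(11)[of r] ins(13) x by (simp add: piece_def W_def)
  have pX: "piece n w pr' x = W (x + r) - W (x + l + 1)"
    using ins by (simp add: piece_def W_def)
  have pQ: "piece n w pr' q = piece n w pr q" if "q \<le> n" "0 < pr q" "q \<noteq> l" "q \<noteq> r" for q
    using ins(11,14) that by (simp add: piece_def)
  \<comment> \<open>\<open>t\<close> is the load of the first site. The boundary next to an end
    moves only if \<open>x\<close> lies in the adjacent gap.\<close>
  have p0n: "piece n w pr' 0 + piece n w pr' n = t"
  proof -
    have "bR n pr' 0 = (if l \<le> 0 then x + l + 1 else bR n pr 0)"
      using ins(9) ins(11)[of 0] site_0 by auto
    moreover have "bL n pr' n = (if n \<le> r then x + r else bL n pr n)"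
      using ins(4) ins(13) ins(14)[of n] site_n by auto
    moreover have "bL n pr' 0 = 0" "bR n pr' n = 2 * n" by (simp_all add: bL_def bR_def)
    ultimately show ?thesis by (simp add: piece_def t_def W_def)
  qed
  have nn: "0 \<le> piece n w pr' q" if "q \<le> n" "0 < pr' q" for q
    using mono[OF L.bL_le_bR[OF that]] by (simp add: piece_def W_def)
  have "max_load G \<pi> ?S \<le> z \<longleftrightarrow> (\<forall>q \<le> n. 0 < pr' q \<longrightarrow> piece n w pr' q \<le> z) \<and> t \<le> z" for z
  proof -
    have "max_load G \<pi> ?S \<le> z \<longleftrightarrow> (\<forall>k < length ?S. load G \<pi> ?S k \<le> z)"
      by (rule max_load_le_iff) simp
    also have "\<dots> \<longleftrightarrow> (\<forall>q < n. 0 < pr' q \<longrightarrow> (if q = 0 then t else piece n w pr' q) \<le> z)"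
    proof (intro iffI allI impI)
      fix q assume *: "\<forall>k < length ?S. load G \<pi> ?S k \<le> z" and q: "q < n" "0 < pr' q"
      then obtain k where k: "k < length ?S" "?S ! k = c (int q)"
        unfolding pr'_def prio_pos_iff in_set_conv_nth by auto
      show "(if q = 0 then t else piece n w pr' q) \<le> z"
        using * k(1) load_piece[OF c S' pr'_def w k q(1)] p0n by auto
    next
      fix k assume *: "\<forall>q < n. 0 < pr' q \<longrightarrow> (if q = 0 then t else piece n w pr' q) \<le> z"
        and k: "k < length ?S"
      then have "?S ! k \<in> verts G" using S'(2) nth_mem by blast
      then obtain q where q: "q < n" "?S ! k = c (int q)" using cyc_enum_verts[OF c] by auto
      then have "0 < pr' q" using k prio_nth[OF S'(1), of k] by (simp add: pr'_def)
      then show "load G \<pi> ?S k \<le> z"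
        using * q load_piece[OF c S' pr'_def w k q(2,1)] p0n by auto
    qed
    also have "\<dots> \<longleftrightarrow> (\<forall>q \<le> n. 0 < pr' q \<longrightarrow> piece n w pr' q \<le> z) \<and> t \<le> z"
    proof (intro iffI conjI allI impI)
      assume *: "\<forall>q < n. 0 < pr' q \<longrightarrow> (if q = 0 then t else piece n w pr' q) \<le> z"
      show t: "t \<le> z" using spec[OF *, of 0] n_pos L.site_0 by simp
      \<comment> \<open>Each end piece is dominated by the sum of both, so listing it separately
        adds no constraint.\<close>
      have "piece n w pr' 0 \<le> t" "piece n w pr' n \<le> t"
        using nn[of 0] nn[of n] L.site_0 L.site_n p0n by auto
      then show "piece n w pr' q \<le> z" if "q \<le> n" "0 < pr' q" for q
      proof (cases "q = 0 \<or> q = n")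
        case False
        then show ?thesis using spec[OF *, of q] that by auto
      qed (use t in auto)
    qed auto
    finally show ?thesis .
  qed
  moreover have "new_load n w pr x \<le> z \<longleftrightarrow> (\<forall>q \<le> n. 0 < pr' q \<longrightarrow> piece n w pr' q \<le> z) \<and> t \<le> z" for z
  proof -
    have LM: "left_max n w pr l \<le> z \<longleftrightarrow> 0 \<le> z \<and> (\<forall>q < l. 0 < pr q \<longrightarrow> piece n w pr q \<le> z)"
      unfolding left_max_def by (subst Max_le_iff) auto
    have RM: "right_max n w pr r \<le> z \<longleftrightarrow> 0 \<le> z \<and> (\<forall>q. r < q \<and> q \<le> n \<and> 0 < pr q \<longrightarrow> piece n w pr q \<le> z)"
      unfolding right_max_def by (subst Max_le_iff) auto
    have "(\<forall>q \<le> n. 0 < pr' q \<longrightarrow> piece n w pr' q \<le> z) \<longleftrightarrow>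
       (\<forall>q < l. 0 < pr q \<longrightarrow> piece n w pr q \<le> z) \<and>
       (\<forall>q. r < q \<and> q \<le> n \<and> 0 < pr q \<longrightarrow> piece n w pr q \<le> z) \<and>
       piece n w pr' l \<le> z \<and> piece n w pr' r \<le> z \<and> piece n w pr' x \<le> z" (is "?A \<longleftrightarrow> ?B")
    proof
      assume A: ?A
      have "piece n w pr q \<le> z" if "q \<le> n" "0 < pr q" "q \<noteq> l" "q \<noteq> r" for q
        using A pos[of q] pQ[OF that] that by auto
      moreover have "piece n w pr' q \<le> z" if "q = l \<or> q = r \<or> q = x" for q
        using spec[OF A, of q] pos[of q] that ins(2-6) x by auto
      ultimately show ?B using ins(2-6) x by auto
    next
      assume B: ?B
      show ?A
      proof (intro allI impI)
        fix q assume q: "q \<le> n" "0 < pr' q"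
        show "piece n w pr' q \<le> z"
        proof (cases "q = x \<or> q = l \<or> q = r")
          case False
          then have "0 < pr q" using pos q by auto
          then show ?thesis using ins(8)[of q] pQ[of q] q False B by auto
        qed (use B in auto)
      qed
    qed
    moreover have "0 \<le> t" using nn[of 0] nn[of n] L.site_0 L.site_n p0n by auto
    ultimately show ?thesis
      unfolding new_load_def Let_def l_def[symmetric] r_def[symmetric] W_def[symmetric] t_def[symmetric]
      by (auto simp: LM RM pL pR pX)
  qed
  ultimately show ?thesis by (metis order.antisym order.refl)
qed

lemma load_le_total:
  assumes "finite (verts G)" "\<And>v. v \<in> verts G \<Longrightarrow> 0 \<le> \<pi> v"
  shows "load G \<pi> S k \<le> sum \<pi> (verts G)"
  unfolding load_def by (rule sum_mono2) (use assms in \<open>auto simp: territory_def\<close>)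


subsection \<open>The program\<close>

definition rmax :: "nat \<Rightarrow> nat \<Rightarrow> com" where
  "rmax a b = IfR b a Skip (Ins (RMove a b))"

definition add_unless :: "nat \<Rightarrow> nat \<Rightarrow> nat \<Rightarrow> nat \<Rightarrow> com" where
  "add_unless a b x y = IfI a b Skip (Ins (IAdd x x y))"

definition move_if :: "nat \<Rightarrow> nat \<Rightarrow> nat \<Rightarrow> nat \<Rightarrow> com" where
  "move_if a b x y = IfI a b (Ins (IMove x y)) Skip"

definition add_if :: "nat \<Rightarrow> nat \<Rightarrow> nat \<Rightarrow> nat \<Rightarrow> nat \<Rightarrow> com" where
  "add_if a b x y z = IfI a b (Ins (RAdd x x y)) (Ins (RAdd x x z))"

definition sub_if :: "nat \<Rightarrow> nat \<Rightarrow> nat \<Rightarrow> nat \<Rightarrow> nat \<Rightarrow> com" where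
  "sub_if a b x y z = IfI a b (Ins (RSub x x y)) (Ins (RSub x x z))"

lemmas macro_defs = rmax_def add_unless_def move_if_def add_if_def sub_if_def

text \<open>The conditionals move into the updated values, so symbolic execution carries one state
  instead of splitting at every branch.\<close>

lemma sem_macros [simp]:
  "sem (rmax a b) s = s\<lparr>rreg := (rreg s)(a := max (rreg s a) (rreg s b))\<rparr>"
  "sem (add_unless i j x y) s =
     s\<lparr>ireg := (ireg s)(x := ireg s x + (if ireg s i \<le> ireg s j then 0 else ireg s y))\<rparr>"
  "sem (move_if i j x y) s =
     s\<lparr>ireg := (ireg s)(x := if ireg s i \<le> ireg s j then ireg s y else ireg s x)\<rparr>"
  "sem (add_if i j a b d) s =
     s\<lparr>rreg := (rreg s)(a := rreg s a + (if ireg s i \<le> ireg s j then rreg s b else rreg s d))\<rparr>"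
  "sem (sub_if i j a b d) s =
     s\<lparr>rreg := (rreg s)(a := rreg s a - (if ireg s i \<le> ireg s j then rreg s b else rreg s d))\<rparr>"
  by (auto simp: macro_defs max_def)

fun block :: "instr list \<Rightarrow> com" where
  "block [] = Skip"
| "block (i # xs) = Ins i ;; block xs"

text \<open>
  Natural number registers: 1, 2, 3, 15 hold \<open>n\<close>, \<open>p\<close>, \<open>1\<close>, \<open>0\<close>; 4 to 7 hold the bases of the arrays of
  priorities (by vertex), vertices, next sites and right boundaries (by position); 8 is the base of
  the adjacency lists and 14 of the array of right maxima, the prefix sums starting at \<open>n\<close>; 9 is
  the current position. Register 0 keeps the best vertex and real register 6 its load. Positions
  are those of the line, and the three arrays computed from right to left are filled at sites only.
\<close>

definition prelude :: com where
  "prelude = block [IConst 3 1, ILoad 1 15, ILoad 2 3, IAdd 8 2 3, IAdd 8 8 3, IAdd 4 1 1, IAdd 4 4 1,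
     IAdd 14 4 3, IAdd 4 4 8, IAdd 5 4 1, IAdd 6 5 1, IAdd 6 6 3, IAdd 7 6 1, IAdd 7 7 3]"

text \<open>The counter is incremented before the store, so that priorities start at 1.\<close>

definition mark_body :: com where
  "mark_body = block [IAdd 12 9 3, IAdd 12 12 3, ILoad 12 12, IAdd 12 12 4, IAdd 9 9 3, IStore 12 9]"

text \<open>The record of vertex \<open>v\<close> starts \<open>3 * v\<close> cells after the base.
  The second neighbour of the first site becomes its predecessor, which fixes the direction of the
  walk.\<close>

definition walk_init :: com where
  "walk_init = block [IMove 9 15, IConst 12 2, ILoad 10 12, IAdd 12 8 10, IAdd 12 12 10, IAdd 12 12 10,
     IAdd 12 12 3, IAdd 12 12 3, ILoad 11 12, RSub 0 0 0, RStore 1 0]"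

text \<open>The next vertex is the sum of the two neighbours minus the previous vertex.\<close>

definition walk_body :: com where
  "walk_body = block [IAdd 12 5 9, IStore 12 10, IAdd 13 1 9, IAdd 13 13 9, RLoad 1 10, RAdd 0 0 1,
     IAdd 13 13 3, RStore 13 0, IAdd 13 13 3, RStore 13 0,
     IAdd 12 8 10, IAdd 12 12 10, IAdd 12 12 10, IAdd 12 12 3, ILoad 13 12, IAdd 12 12 3, ILoad 12 12,
     IAdd 13 13 12, ISub 13 13 11, IMove 11 10, IMove 10 13, IAdd 9 9 3]"

text \<open>After the walk register 10 holds the first site again, now stored as the copy at
  position \<open>n\<close>. Registers 16 to 18 describe the nearest site to the right: position,
  right boundary, priority.\<close>

definition back_init :: com where
  "back_init = block [IAdd 12 5 9, IStore 12 10, IMove 16 1, IAdd 17 1 1, IMove 18 3, IAdd 12 7 1,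
     IStore 12 17, RSub 2 2 2]"

text \<open>While register 16 still equals \<open>n\<close>, the boundary just computed is the left
  boundary of \<open>n\<close>; register 19 saves it for the scan.\<close>

definition back_body :: com where
  "back_body = block [ISub 9 9 3, IAdd 12 5 9, ILoad 12 12, IAdd 12 12 4, ILoad 12 12] ;;
     IfI 12 15 Skip (
       Ins (IAdd 13 9 16) ;; add_unless 18 12 13 3 ;;
       block [IAdd 23 6 9, IStore 23 16, IAdd 23 7 9, IStore 23 13, IAdd 23 14 9, RStore 23 2] ;;
       move_if 1 16 19 13 ;;
       block [IAdd 23 1 17, RLoad 3 23, IAdd 23 1 13, RLoad 4 23, RSub 3 3 4] ;; rmax 2 3 ;;
       block [IMove 16 9, IMove 17 13, IMove 18 12])"

text \<open>The best load starts with the total cost, so the first candidate always replaces it.\<close>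

definition scan_init :: com where
  "scan_init = block [IMove 20 15, IMove 21 15, IMove 22 15, RSub 5 5 5, RMove 6 0, ILoad 12 7,
     IAdd 12 1 12, RLoad 9 12, IAdd 12 1 19, RLoad 10 12]"

text \<open>Reaching a site closes the gap before it: the cell of the previous site, still bounded
  by registers 21 and 22, enters the left maximum, and its right boundary becomes the new left
  one.\<close>

definition scan_site :: com where
  "scan_site = block [IAdd 12 1 22, RLoad 3 12, IAdd 12 1 21, RLoad 4 12, RSub 3 3 4] ;; rmax 5 3 ;;
     block [IMove 21 22, IMove 20 9, IAdd 12 6 9, ILoad 16 12, IAdd 12 7 9, ILoad 22 12, IAdd 12 7 16,
       ILoad 17 12, IAdd 12 14 9, RLoad 2 12]"

definition scan_load :: com where
  "scan_load = block [IAdd 12 9 20, IAdd 12 12 3, IAdd 12 1 12, RLoad 3 12,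
       IAdd 12 9 16, IAdd 12 1 12, RLoad 4 12, RSub 7 4 3] ;; rmax 7 5 ;; rmax 7 2 ;;
     block [IAdd 12 1 21, RLoad 8 12, RSub 8 3 8] ;; rmax 7 8 ;;
     block [IAdd 12 1 17, RLoad 8 12, RSub 8 8 4] ;; rmax 7 8 ;;
     Ins (RMove 8 0) ;; add_if 20 15 8 3 9 ;; sub_if 1 16 8 4 10 ;; rmax 7 8"

definition scan_cand :: com where
  "scan_cand = scan_load ;; IfR 7 6 (block [RMove 6 7, IMove 0 10]) Skip"

definition scan_body :: com where
  "scan_body = block [IAdd 12 5 9, ILoad 10 12, IAdd 12 10 4, ILoad 12 12] ;;
     IfI 12 15 scan_cand scan_site ;; Ins (IAdd 9 9 3)"

definition bv_main :: com where
  "bv_main = While 2 9 mark_body ;; walk_init ;; While 1 9 walk_body ;; back_init ;;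
     While 9 15 back_body ;; scan_init ;; While 1 9 scan_body"

text \<open>\<open>M\<close> is the initial memory and \<open>A\<close> the end of the input. As
  neighbours come in any order, only their sum is fixed at each vertex; the position of one
  neighbour matters only at the start, for the direction.\<close>

locale bv_cycle =
  fixes G :: "nat ugraph" and \<pi> :: "nat \<Rightarrow> real" and S :: "nat list" and n :: nat and c :: "int \<Rightarrow> nat"
    and M :: "nat \<Rightarrow> nat" and p A :: nat
  assumes c: "cyc_enum G n c" and S: "distinct S" "set S \<subseteq> verts G" "S \<noteq> []" and c0: "c 0 = S ! 0"
    and verts: "verts G = {..<n}" and nonneg: "\<And>v. v < n \<Longrightarrow> 0 \<le> \<pi> v"
    and p: "p = length S" and A: "A = 2 + p + 3 * n"
    and M_S: "\<And>k. k < p \<Longrightarrow> M (2 + k) = S ! k"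
    and M_adj: "\<And>i. M (p + 2 + c i + c i + c i + 1) + M (p + 2 + c i + c i + c i + 1 + 1) = c (i - 1) + c (i + 1)"
    and M_prev: "M (p + 2 + c 0 + c 0 + c 0 + 1 + 1) = c (-1)"
begin

definition pr :: "nat \<Rightarrow> nat" where "pr i = prio S (c (int i))"

definition w :: "nat \<Rightarrow> real" where "w i = \<pi> (c (int i))"

definition W :: "nat \<Rightarrow> real" where "W = psum n w"

lemma c_less: "c i < n"
  using c verts by (auto simp: cyc_enum_def)

lemma c0_in: "c 0 \<in> set S"
  using c0 S by simp

sublocale line n pr
  unfolding pr_def[abs_def] by (rule line_prio[OF c c0_in])

definition base :: "ram_state \<Rightarrow> bool" where
  "base s \<longleftrightarrow> ireg s 1 = n \<and> ireg s 2 = p \<and> ireg s 3 = 1 \<and> ireg s 4 = A \<and> ireg s 5 = A + n \<and>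
     ireg s 6 = A + n + n + 1 \<and> ireg s 7 = A + n + n + n + 2 \<and> ireg s 8 = p + 2 \<and>
     ireg s 14 = n + n + n + 1 \<and> ireg s 15 = 0 \<and>
     (\<forall>a < A. imem s a = M a) \<and> (\<forall>v < n. rmem s v = \<pi> v)"

lemma base_M: "base s \<Longrightarrow> a < A \<Longrightarrow> imem s a = M a"
  by (simp add: base_def)

lemma A_adj: "v < n \<Longrightarrow> p + 2 + v + v + v + 1 + 1 < A"
  by (simp add: A)

section \<open>Marking the sites and walking along the cycle\<close>

definition mark_inv :: "nat \<Rightarrow> ram_state \<Rightarrow> bool" where
  "mark_inv i s \<longleftrightarrow> base s \<and> ireg s 9 = i \<and> (\<forall>v < n. imem s (A + v) = prio (take i S) v)"

lemma mark_step: "i < p \<Longrightarrow> ht (mark_inv i) mark_body 6 (mark_inv (Suc i))"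
proof (rule ht_sem)
  fix s assume i: "i < p" and I: "mark_inv i s"
  have Si: "S ! i < n" using S(2) verts i p by (metis lessThan_iff nth_mem subsetD)
  have "S ! i \<notin> set (take i S)"
    using S(1) i p by (auto simp: in_set_conv_nth nth_eq_iff_index_eq)
  then have pr: "prio (take (Suc i) S) v = (if v = S ! i then Suc i else prio (take i S) v)" for v
    using prio_snoc[of "take i S" "S ! i" v] S(1) i p by (simp add: take_Suc_conv_app_nth)
  have "2 + i < A" using i A by simp
  then have m: "imem s (2 + i) = S ! i" using base_M[of s "2 + i"] I M_S[OF i] by (simp add: mark_inv_def)
  show "mark_inv (Suc i) (sem mark_body s)"
    using I m Si unfolding mark_inv_def base_def mark_body_def
    by (auto simp: pr)
qed (simp_all add: mark_body_def)

lemma mark_loop: "ht (mark_inv 0) (While 2 9 mark_body) (p * 8 + 1) (mark_inv p)"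
proof -
  have "ireg s 2 \<le> ireg s 9 \<longleftrightarrow> i = p" if "i \<le> p" "mark_inv i s" for i s
    using that by (auto simp: mark_inv_def base_def)
  from ht_while[where I = mark_inv, OF mark_step this] show ?thesis by simp
qed

definition prios :: "ram_state \<Rightarrow> bool" where
  "prios s \<longleftrightarrow> base s \<and> (\<forall>v < n. imem s (A + v) = prio S v)"

definition walk_inv :: "nat \<Rightarrow> ram_state \<Rightarrow> bool" where
  "walk_inv i s \<longleftrightarrow> prios s \<and> ireg s 9 = i \<and> ireg s 10 = c (int i) \<and> ireg s 11 = c (int i - 1) \<and>
     (\<forall>j < i. imem s (A + n + j) = c (int j)) \<and> (\<forall>j \<le> 2 * i. rmem s (n + j) = W j) \<and>
     rreg s 0 = W (2 * i)"

lemma walk_init: "ht (mark_inv p) walk_init 11 (walk_inv 0)"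
proof (rule ht_sem)
  fix s assume I: "mark_inv p s"
  have "0 < p" using S p by simp
  moreover from this have "2 < A" using A by simp
  ultimately have "imem s 2 = c 0" using I M_S[of 0] base_M[of s 2] by (simp add: mark_inv_def c0)
  moreover have "imem s (p + 2 + c 0 + c 0 + c 0 + 1 + 1) = c (-1)"
    using I M_prev base_M[OF _ A_adj[OF c_less], of s 0] by (simp add: mark_inv_def)
  ultimately show "walk_inv 0 (sem walk_init s)"
    using I p unfolding walk_inv_def prios_def mark_inv_def base_def walk_init_def
    by (simp add: W_def)
qed (simp_all add: walk_init_def)

lemma walk_step: "i < n \<Longrightarrow> ht (walk_inv i) walk_body 22 (walk_inv (Suc i))"
proof (rule ht_sem)
  fix s assume i: "i < n" and I: "walk_inv i s"
  let ?v = "c (int i)"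
  have v: "?v < n" by (rule c_less)
  have m: "imem s (p + 2 + ?v + ?v + ?v + 1) = M (p + 2 + ?v + ?v + ?v + 1)"
      "imem s (p + 2 + ?v + ?v + ?v + 1 + 1) = M (p + 2 + ?v + ?v + ?v + 1 + 1)"
    using I base_M[of s] A_adj[OF v] by (simp_all add: walk_inv_def prios_def)
  have nb: "M (p + 2 + ?v + ?v + ?v + 1) + M (p + 2 + ?v + ?v + ?v + 1 + 1) - c (int i - 1) = c (int i + 1)"
    using M_adj[of "int i"] by simp
  have W: "W (Suc (2 * i)) = W (2 * i) + \<pi> ?v" "W (Suc (Suc (2 * i))) = W (2 * i) + \<pi> ?v"
    using psum_odd[OF i, of w] psum_even[of n w i] by (simp_all add: W_def w_def)
  have rv: "rmem s ?v = \<pi> ?v" using I v by (simp add: walk_inv_def prios_def base_def)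
  define s' where "s' = sem walk_body s"
  \<comment> \<open>Scratch registers are named by their final values, so their content need not be
    computed.\<close>
  define a b where "a = ireg s' 12" and "b = ireg s' 13"
  have 1: "ireg s' = (ireg s)(9 := Suc i, 10 := c (int i + 1), 11 := ?v, 12 := a, 13 := b)"
    "imem s' = (imem s)(A + n + i := ?v)"
    "rmem s' = (rmem s)(n + (2 * i + 1) := W (2 * i + 1), n + (2 * i + 2) := W (2 * i + 2))"
    "rreg s' = (rreg s)(0 := W (2 * i + 2), 1 := \<pi> ?v)"
    using I m nb v i W rv A_adj[OF v]
    unfolding walk_inv_def prios_def base_def a_def b_def s'_def walk_body_def
    by (simp_all add: fun_upd_twist algebra_simps fun_eq_iff)
  have "base s'" using I 1(1) v i A unfolding walk_inv_def prios_def base_def 1(2,3) by simp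
  moreover have "rmem s' (n + j) = W j" if j: "j \<le> 2 * Suc i" for j
  proof -
    have "j \<le> 2 * i \<or> j = 2 * i + 1 \<or> j = 2 * i + 2" using j by auto
    then show ?thesis using I unfolding 1(3) walk_inv_def by auto
  qed
  ultimately show "walk_inv (Suc i) s'"
    using I 1 unfolding walk_inv_def prios_def by (auto simp: less_Suc_eq add.commute[of 1])
qed (simp_all add: walk_body_def)


lemma walk_loop: "ht (walk_inv 0) (While 1 9 walk_body) (n * 24 + 1) (walk_inv n)"
proof -
  have "ireg s 1 \<le> ireg s 9 \<longleftrightarrow> i = n" if "i \<le> n" "walk_inv i s" for i s
    using that by (auto simp: walk_inv_def prios_def base_def)
  from ht_while[where I = walk_inv, OF walk_step this] show ?thesis by simp
qed

definition walked :: "ram_state \<Rightarrow> bool" where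
  "walked s \<longleftrightarrow> prios s \<and> (\<forall>j \<le> n. imem s (A + n + j) = c (int j)) \<and>
     (\<forall>j \<le> 2 * n. rmem s (n + j) = W j) \<and> rreg s 0 = W (2 * n)"

lemma walked_pr:
  assumes "walked s" "i \<le> n"
  shows "imem s (A + n + i) = c (int i)" "imem s (A + c (int i)) = pr i" "imem s (c (int i) + A) = pr i"
  using assms c_less[of "int i"] by (auto simp: walked_def prios_def pr_def add.commute)

text \<open>A gap is filed under its left site \<open>q\<close>, where the scan enters it; the
  stored maximum excludes both sites bounding the gap.\<close>

definition gap_at :: "ram_state \<Rightarrow> nat \<Rightarrow> bool" where
  "gap_at s q \<longleftrightarrow> imem s (A + n + n + 1 + q) = nx pr (Suc q) \<and>
     imem s (A + n + n + n + 2 + q) = bR n pr q \<and>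
     rmem s (n + n + n + 1 + q) = right_max n w pr (nx pr (Suc q))"

definition gaps_from :: "ram_state \<Rightarrow> nat \<Rightarrow> bool" where
  "gaps_from s i \<longleftrightarrow> walked s \<and> imem s (A + n + n + n + 2 + n) = 2 * n \<and>
     (\<forall>q. i \<le> q \<and> q < n \<and> 0 < pr q \<longrightarrow> gap_at s q)"

text \<open>\<open>k\<close> counts rounds while the position falls from \<open>n\<close>. Register
  19 is meaningful only after a site before \<open>n\<close> has been met.\<close>

definition back_inv :: "nat \<Rightarrow> ram_state \<Rightarrow> bool" where
  "back_inv k s \<longleftrightarrow> gaps_from s (n - k) \<and> ireg s 9 = n - k \<and> ireg s 16 = nx pr (n - k) \<and>
     ireg s 17 = bR n pr (nx pr (n - k)) \<and> ireg s 18 = pr (nx pr (n - k)) \<and>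
     rreg s 2 = right_max n w pr (nx pr (n - k)) \<and> (nx pr (n - k) < n \<longrightarrow> ireg s 19 = bL n pr n)"

lemma pr_0: "pr 0 = 1"
  using prio_nth[OF S(1), of 0] S(3) by (simp add: pr_def c0)

lemma right_max_n: "right_max n w pr n = 0"
proof -
  have "{q. n < q \<and> q \<le> n \<and> 0 < pr q} = {}" by auto
  then show ?thesis unfolding right_max_def by (simp only: image_empty Max_singleton)
qed

lemma Max_image_insert:
  fixes f :: "'a \<Rightarrow> real"
  assumes "finite Q" shows "Max (insert 0 (f ` insert q Q)) = max (Max (insert 0 (f ` Q))) (f q)"
  using assms by (simp add: insert_commute[of 0] max.commute del: Max_insert) (simp add: max.commute)

lemma back_init: "ht (walk_inv n) back_init 8 (back_inv 0)"
proof (rule ht_sem)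
  fix s assume I: "walk_inv n s"
  define s' where "s' = sem back_init s"
  define a where "a = ireg s' 12"
  have 1: "ireg s' = (ireg s)(12 := a, 16 := n, 17 := 2 * n, 18 := 1)"
    "imem s' = (imem s)(A + n + n := c (int n), A + n + n + n + 2 + n := 2 * n)"
    "rmem s' = rmem s" "rreg s' = (rreg s)(2 := 0)"
    using I unfolding walk_inv_def prios_def base_def a_def s'_def back_init_def
    by (simp_all add: fun_upd_twist fun_eq_iff)
  have "nx pr n = n" using nx_self site_n by simp
  moreover have "base s'" using I 1(1) unfolding walk_inv_def prios_def base_def 1(2,3) by simp
  then have "walked s'"
    using I unfolding walked_def prios_def walk_inv_def 1(2-4)
    by (auto simp: le_less)
  ultimately show "back_inv 0 s'"
    using 1 I pr_0 pr_n right_max_n unfolding back_inv_def gaps_from_def walk_inv_def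
    by (auto simp: bR_def)
qed (simp_all add: back_init_def)


text \<open>Beyond \<open>i\<close> lie the next site and the sites beyond that one; the left
  boundary of the next site is the right boundary of \<open>i\<close>.\<close>

lemma right_max_step:
  assumes i: "i < n" "0 < pr i"
  defines "r \<equiv> nx pr (Suc i)"
  shows "right_max n w pr i = max (right_max n w pr r) (W (bR n pr r) - W (bR n pr i))"
proof -
  note r = nx[OF Suc_leI[OF i(1)], folded r_def]
  have "q \<in> {q. i < q \<and> q \<le> n \<and> 0 < pr q} \<longleftrightarrow> q \<in> insert r {q. r < q \<and> q \<le> n \<and> 0 < pr q}" for q
    using r(1-3) r(4)[of q] by (cases "q = r") auto
  then have "{q. i < q \<and> q \<le> n \<and> 0 < pr q} = insert r {q. r < q \<and> q \<le> n \<and> 0 < pr q}" by blast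
  then have "right_max n w pr i = max (right_max n w pr r) (piece n w pr r)"
    unfolding right_max_def by (simp only:) (rule Max_image_insert, simp)
  then show ?thesis using bL_nx[OF i] by (simp add: piece_def W_def r_def)
qed

lemma left_max_step:
  assumes i: "0 < i" "0 < pr i"
  defines "l \<equiv> prv pr i"
  shows "left_max n w pr i = max (left_max n w pr l) (W (bR n pr l) - W (bL n pr l))"
proof -
  note l = prv[OF i(1), folded l_def]
  have "q \<in> {q. q < i \<and> 0 < pr q} \<longleftrightarrow> q \<in> insert l {q. q < l \<and> 0 < pr q}" for q
    using l(1,2) l(3)[of q] by (cases "q = l") auto
  then have "{q. q < i \<and> 0 < pr q} = insert l {q. q < l \<and> 0 < pr q}" by blast
  then have "left_max n w pr i = max (left_max n w pr l) (piece n w pr l)"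
    unfolding left_max_def by (simp only:) (rule Max_image_insert, simp)
  then show ?thesis by (simp add: piece_def W_def)
qed

lemma back_step: "k < n \<Longrightarrow> ht (back_inv k) back_body 40 (back_inv (Suc k))"
proof (rule ht_sem)
  fix s assume k: "k < n" and I: "back_inv k s"
  define i where "i = n - Suc k"
  have i: "i < n" "n - k = Suc i" using k by (auto simp: i_def)
  define s' where "s' = sem back_body s"
  define a b d where "a = ireg s' 12" and "b = ireg s' 13" and "d = ireg s' 23"
  have w: "walked s" "base s" using I by (auto simp: back_inv_def gaps_from_def walked_def prios_def)
  note m = walked_pr[OF w(1), of i]
  note nx_i = nx[of "Suc i"]
  show "back_inv (Suc k) s'"
  proof (cases "pr i = 0")
    case True
    have 1: "ireg s' = (ireg s)(9 := i, 12 := a)" "imem s' = imem s" "rmem s' = rmem s" "rreg s' = rreg s"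
      using I m i True w(2) unfolding back_inv_def base_def a_def s'_def back_body_def
      by (simp_all add: fun_upd_twist fun_eq_iff)
    have "nx pr i = nx pr (Suc i)" using nx_skip i True by simp
    moreover have "gap_at s' q = gap_at s q" for q by (simp add: gap_at_def 1)
    moreover have "walked s'" using w unfolding walked_def prios_def base_def by (simp add: 1)
    moreover have "Suc i \<le> q" if "i \<le> q" "0 < pr q" for q using that True by (cases "q = i") auto
    ultimately show ?thesis
      using I i unfolding back_inv_def gaps_from_def i_def[symmetric] by (auto simp: 1)
  next
    case False
    define r where "r = nx pr (Suc i)"
    \<comment> \<open>The first alternative occurs exactly at the last site before
      \<open>n\<close>.\<close>
    define f where "f = (if n \<le> r then bR n pr i else ireg s 19)"
    define y z where "y = rreg s' 3" and "z = rreg s' 4"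
    have r: "Suc i \<le> r" "r \<le> n" "0 < pr r" using nx_i i by (auto simp: r_def)
    have bb: "i + r + (if pr r \<le> pr i then 0 else Suc 0) = bR n pr i" using i by (simp add: bR_def r_def)
    have bn: "bR n pr r \<le> 2 * n" "bR n pr i \<le> 2 * n"
      using bR_bounds(2)[of r] bR_bounds(2)[of i] r i False by auto
    have Wm: "rmem s (n + bR n pr r) = W (bR n pr r)" "rmem s (n + bR n pr i) = W (bR n pr i)"
      using w(1) bn by (auto simp: walked_def)
    have 1: "ireg s' = (ireg s)(9 := i, 12 := a, 13 := b, 23 := d, 16 := i, 17 := bR n pr i, 18 := pr i, 19 := f)"
      "imem s' = (imem s)(A + n + n + 1 + i := r, A + n + n + n + 2 + i := bR n pr i)"
      "rmem s' = (rmem s)(n + n + n + 1 + i := right_max n w pr r)"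
      "rreg s' = (rreg s)(2 := right_max n w pr i, 3 := y, 4 := z)"
      using I m i False w(2) Wm bn
      unfolding back_inv_def base_def a_def b_def d_def y_def z_def f_def s'_def back_body_def
      by (simp_all add: fun_upd_twist fun_eq_iff bb right_max_step flip: r_def split del: if_split cong: if_cong)
    have "base s'" using w(2) i unfolding base_def 1 by simp
    then have "walked s'" using w(1) i unfolding walked_def prios_def 1 by simp
    moreover have "gap_at s' i" by (simp add: gap_at_def 1 r_def)
    moreover have "gap_at s' q" if "gap_at s q" "i < q" "q < n" for q
      using that i by (simp add: gap_at_def 1)
    moreover have "f = bL n pr n"
    proof (cases "n \<le> r")
      case True
      then show ?thesis using r bL_nx[of i] i False by (simp add: f_def r_def)
    next
      case False
      then show ?thesis using I i by (simp add: f_def r_def back_inv_def)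
    qed
    ultimately show ?thesis
      using I i nx_self[of i] False unfolding back_inv_def gaps_from_def i_def[symmetric]
      by (auto simp: 1 Suc_le_eq le_eq_less_or_eq[of i])
  qed
qed (simp_all add: back_body_def macro_defs)

lemma back_loop: "ht (back_inv 0) (While 9 15 back_body) (n * 42 + 1) (back_inv n)"
proof -
  have "ireg s 9 \<le> ireg s 15 \<longleftrightarrow> i = n" if "i \<le> n" "back_inv i s" for i s
    using that by (auto simp: back_inv_def gaps_from_def walked_def prios_def base_def)
  from ht_while[where I = back_inv, OF back_step this] show ?thesis by simp
qed


section \<open>Scanning the candidates for the smallest load\<close>

definition best_inv :: "nat \<Rightarrow> ram_state \<Rightarrow> bool" where
  "best_inv i s \<longleftrightarrow> (\<forall>x < i. pr x = 0 \<longrightarrow> rreg s 6 \<le> new_load n w pr x) \<and>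
     (rreg s 6 = W (2 * n) \<and> (\<forall>x < i. 0 < pr x) \<or>
      (\<exists>x < i. pr x = 0 \<and> ireg s 0 = c (int x) \<and> rreg s 6 = new_load n w pr x))"

definition gap_inv :: "nat \<Rightarrow> ram_state \<Rightarrow> bool" where
  "gap_inv l s \<longleftrightarrow> ireg s 20 = l \<and> ireg s 21 = bL n pr l \<and> ireg s 22 = bR n pr l \<and>
     ireg s 16 = nx pr (Suc l) \<and> ireg s 17 = bR n pr (nx pr (Suc l)) \<and>
     rreg s 2 = right_max n w pr (nx pr (Suc l)) \<and> rreg s 5 = left_max n w pr l"

text \<open>No site precedes position 0; the zeros stand for an empty cell, so the program treats
  the first site like any other.\<close>

definition scan_inv :: "nat \<Rightarrow> ram_state \<Rightarrow> bool" where
  "scan_inv i s \<longleftrightarrow> gaps_from s 0 \<and> ireg s 9 = i \<and> rreg s 9 = W (bR n pr 0) \<and>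
     rreg s 10 = W (bL n pr n) \<and> best_inv i s \<and>
     (if i = 0 then ireg s 21 = 0 \<and> ireg s 22 = 0 \<and> rreg s 5 = 0 else gap_inv (prv pr i) s)"

lemma left_max_0: "left_max n w pr 0 = 0"
  by (simp add: left_max_def)

lemma gaps_from_cong:
  assumes "gaps_from s i" "base s'" "imem s' = imem s" "rmem s' = rmem s" "rreg s' 0 = rreg s 0"
  shows "gaps_from s' i"
  using assms by (simp add: gaps_from_def walked_def prios_def gap_at_def)

lemma scan_init: "ht (back_inv n) scan_init 10 (scan_inv 0)"
proof (rule ht_sem)
  fix s assume I: "back_inv n s"
  define s' where "s' = sem scan_init s"
  define a where "a = ireg s' 12"
  have w: "gaps_from s 0" "walked s" "base s" "gap_at s 0" using I n_pos site_0
    by (auto simp: back_inv_def gaps_from_def walked_def prios_def)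
  have "bR n pr 0 \<le> 2 * n" "bL n pr n \<le> 2 * n"
    using bR_bounds(2)[of 0] bL_bounds[of n] site_0 site_n by auto
  then have Wm: "rmem s (n + bR n pr 0) = W (bR n pr 0)" "rmem s (n + bL n pr n) = W (bL n pr n)"
    "rreg s 0 = W (2 * n)"
    using w(2) by (auto simp: walked_def)
  have b0: "imem s (A + n + n + n + 2) = bR n pr 0" using w(4) by (simp add: gap_at_def)
  have r19: "ireg s 19 = bL n pr n" using I nx_self[OF site_0] n_pos by (simp add: back_inv_def)
  have 1: "ireg s' = (ireg s)(12 := a, 20 := 0, 21 := 0, 22 := 0)" "imem s' = imem s" "rmem s' = rmem s"
    "rreg s' = (rreg s)(5 := 0, 6 := W (2 * n), 9 := W (bR n pr 0), 10 := W (bL n pr n))"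
    using w(3) b0 r19 Wm unfolding base_def a_def s'_def scan_init_def
    by (simp_all add: fun_upd_twist fun_eq_iff)
  have "base s'" using w(3) unfolding base_def 1 by simp
  then have "gaps_from s' 0" using gaps_from_cong[OF w(1)] 1 by simp
  then show "scan_inv 0 s'" using I unfolding scan_inv_def best_inv_def back_inv_def 1 by simp
qed (simp_all add: scan_init_def)

lemma max_load_new:
  assumes "x < n" "pr x = 0" shows "max_load G \<pi> (S @ [c (int x)]) = new_load n w pr x"
proof (rule max_load_snoc[OF c S(1,2) c0_in])
  show "pr = (\<lambda>i. prio S (c (int i)))" "w = (\<lambda>i. \<pi> (c (int i)))"
    by (auto simp: pr_def w_def)
  show "0 \<le> \<pi> v" if "v \<in> verts G" for v using that nonneg verts by simp
qed (use assms in auto)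

text \<open>Makes the total cost a valid starting value for the minimum.\<close>

lemma new_load_le_total:
  assumes "x < n" "pr x = 0" shows "new_load n w pr x \<le> W (2 * n)"
proof -
  let ?S = "S @ [c (int x)]"
  have "max_load G \<pi> ?S \<le> sum \<pi> (verts G)"
    using load_le_total[of G \<pi>] verts nonneg by (subst max_load_le_iff) auto
  moreover have "sum \<pi> (verts G) = W (2 * n)"
  proof -
    have "inj_on (\<lambda>i. c (int i)) {..<n}" using cyc_enum_eq_nat[OF c] by (auto simp: inj_on_def)
    moreover have "{y. y < n \<and> 2 * y < 2 * n} = {..<n}" by auto
    ultimately show ?thesis
      unfolding cyc_enum_verts[OF c] W_def psum_def by (simp add: sum.reindex w_def)
  qed
  ultimately show ?thesis using max_load_new[OF assms] by simp
qed

text \<open>Once the registers describe the gap around \<open>i\<close>, the value in real register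
  7 has the same nesting of maxima as \<open>new_load\<close>, so unfolding both suffices.\<close>

lemma sem_scan_load:
  fixes l r :: nat
  assumes "ireg s 1 = n" "ireg s 3 = 1" "ireg s 15 = 0" "ireg s 9 = i"
    and "ireg s 20 = l" "ireg s 21 = bL n pr l" "ireg s 16 = r" "ireg s 17 = bR n pr r"
    and "rreg s 2 = right_max n w pr r" "rreg s 5 = left_max n w pr l"
    and "rreg s 9 = W (bR n pr 0)" "rreg s 10 = W (bL n pr n)" "rreg s 0 = W (2 * n)"
    and "rmem s (n + bL n pr l) = W (bL n pr l)" "rmem s (n + bR n pr r) = W (bR n pr r)"
        "rmem s (n + (i + l + 1)) = W (i + l + 1)" "rmem s (n + (i + r)) = W (i + r)"
    and "l = prv pr i" "r = nx pr (Suc i)"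
  shows "sem scan_load s = s\<lparr>ireg := (ireg s)(12 := n + bR n pr r),
    rreg := (rreg s)(3 := W (i + l + 1), 4 := W (i + r), 7 := new_load n w pr i,
      8 := W (2 * n) + (if l \<le> 0 then W (i + l + 1) else W (bR n pr 0))
        - (if n \<le> r then W (i + r) else W (bL n pr n)))\<rparr>"
  using assms(1-17)
  unfolding new_load_def Let_def assms(18,19)[symmetric] W_def[symmetric] scan_load_def
  by (simp add: fun_upd_twist split del: if_split cong: if_cong)

lemma scan_step: "i < n \<Longrightarrow> ht (scan_inv i) scan_body 80 (scan_inv (Suc i))"
proof (rule ht_sem)
  fix s assume i: "i < n" and I: "scan_inv i s"
  define s' where "s' = sem scan_body s"
  define a v where "a = ireg s' 12" and "v = c (int i)"
  have w: "gaps_from s 0" "walked s" "base s" using I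
    by (auto simp: scan_inv_def gaps_from_def walked_def prios_def)
  note m = walked_pr[OF w(2) less_imp_le[OF i], folded v_def]
  have Wm: "rmem s (n + j) = W j" if "j \<le> 2 * n" for j using w(2) that by (simp add: walked_def)
  show "scan_inv (Suc i) s'"
  proof (cases "pr i = 0")
    case False
    define r where "r = nx pr (Suc i)"
    define y z where "y = rreg s' 3" and "z = rreg s' 4"
    have r: "Suc i \<le> r" "r \<le> n" "0 < pr r" using nx[of "Suc i"] i by (auto simp: r_def)
    have g: "gap_at s i" using w(1) i False by (simp add: gaps_from_def)
    have gi: "imem s (A + n + n + 1 + i) = r" "imem s (A + n + n + n + 2 + i) = bR n pr i"
      "rmem s (n + n + n + 1 + i) = right_max n w pr r"
      using g by (auto simp: gap_at_def r_def)
    have gr: "imem s (A + n + n + n + 2 + r) = bR n pr r"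
    proof (cases "r = n")
      case True
      then show ?thesis using w(1) by (simp add: gaps_from_def bR_def)
    next
      case False
      then have "gap_at s r" using w(1) r by (simp add: gaps_from_def)
      then show ?thesis by (simp add: gap_at_def)
    qed
    \<comment> \<open>The right boundary of the previous site is the left boundary of
      \<open>i\<close>; at position 0 both are 0.\<close>
    have 22: "ireg s 22 = bL n pr i" using I by (cases "i = 0") (auto simp: scan_inv_def gap_inv_def bL_def)
    have bn: "ireg s 21 \<le> 2 * n" "bL n pr i \<le> 2 * n"
    proof -
      show "bL n pr i \<le> 2 * n" using bL_bounds[of i] i False by auto
      show "ireg s 21 \<le> 2 * n"
        using I bL_bounds[of "prv pr i"] prv[of i] i by (cases "i = 0") (auto simp: scan_inv_def gap_inv_def)
    qed
    have lm: "max (rreg s 5) (W (bL n pr i) - W (ireg s 21)) = left_max n w pr i"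
      using I left_max_step[of i] left_max_0 False
      by (cases "i = 0") (auto simp: scan_inv_def gap_inv_def bL_def)
    have 1: "ireg s' = (ireg s)(9 := Suc i, 10 := v, 12 := a, 16 := r, 17 := bR n pr r, 20 := i,
        21 := bL n pr i, 22 := bR n pr i)"
      "imem s' = imem s" "rmem s' = rmem s"
      "rreg s' = (rreg s)(2 := right_max n w pr r, 3 := y, 4 := z, 5 := left_max n w pr i)"
      using I m w(3) False gi gr 22 Wm[OF bn(1)] Wm[OF bn(2)] lm
      unfolding base_def a_def y_def z_def s'_def scan_inv_def scan_body_def scan_site_def
      by (simp_all add: fun_upd_twist fun_eq_iff split del: if_split)
    have "base s'" using w(3) unfolding base_def 1 by simp
    then have "gaps_from s' 0" using gaps_from_cong[OF w(1)] 1 by simp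
    moreover have "prv pr (Suc i) = i" using False by (intro prv_eqI) auto
    moreover have "best_inv (Suc i) s'"
      using I False unfolding scan_inv_def best_inv_def 1 by (auto simp: less_Suc_eq)
    ultimately show ?thesis using I unfolding scan_inv_def gap_inv_def by (simp add: 1 r_def)
  next
    case True
    then have i0: "0 < i" using site_0 by (cases i) auto
    define l where "l = prv pr i"
    define r where "r = nx pr (Suc i)"
    have l: "l < i" "0 < pr l" using prv[OF i0] by (auto simp: l_def)
    have r: "i < r" "r \<le> n" "0 < pr r" using nx[of "Suc i"] i by (auto simp: r_def)
    have nl: "nx pr (Suc l) = r"
    proof (rule nx_eqI)
      show "pr k = 0" if "Suc l \<le> k" "k < r" for k
        using prv_max[OF i0, of k] nx_min[of "Suc i" k] that i True
        by (cases "k < i"; cases "k = i") (auto simp: l_def r_def)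
    qed (use l r in auto)
    have pl: "prv pr (Suc i) = l"
    proof (rule prv_eqI)
      show "pr k = 0" if "l < k" "k < Suc i" for k
        using prv_max[OF i0, of k] that True by (cases "k = i") (auto simp: l_def)
    qed (use l in auto)
    have reg: "ireg s 20 = l" "ireg s 21 = bL n pr l" "ireg s 16 = r" "ireg s 17 = bR n pr r"
       "rreg s 2 = right_max n w pr r" "rreg s 5 = left_max n w pr l"
       "rreg s 9 = W (bR n pr 0)" "rreg s 10 = W (bL n pr n)" "rreg s 0 = W (2 * n)"
      using I i0 nl w(2) by (auto simp: scan_inv_def gap_inv_def walked_def simp flip: l_def)
    have bn: "bL n pr l \<le> 2 * n" "bR n pr r \<le> 2 * n" "i + l + 1 \<le> 2 * n" "i + r \<le> 2 * n"
      using bL_bounds[of l] bR_bounds(2)[of r] l r i by auto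
    have m4: "rmem s (n + bL n pr l) = W (bL n pr l)" "rmem s (n + bR n pr r) = W (bR n pr r)"
        "rmem s (n + (i + l + 1)) = W (i + l + 1)" "rmem s (n + (i + r)) = W (i + r)"
      using Wm bn by blast+
    define N where "N = new_load n w pr i"
    \<comment> \<open>The state in which the candidate code starts; the 0 is the priority just
      loaded.\<close>
    define t where "t = s\<lparr>ireg := (ireg s)(12 := 0, 10 := v)\<rparr>"
    define s1 where "s1 = sem scan_load t"
    have s': "s' = sem (Ins (IAdd 9 9 3)) (sem (IfR 7 6 (block [RMove 6 7, IMove 0 10]) Skip) s1)"
      using I m w(3) True unfolding base_def s'_def scan_inv_def scan_body_def scan_cand_def t_def s1_def
      by (simp add: fun_upd_twist)
    define f where "f = W (2 * n) + (if l \<le> 0 then W (i + l + 1) else W (bR n pr 0))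
        - (if n \<le> r then W (i + r) else W (bL n pr n))"
    have s1: "s1 = t\<lparr>ireg := (ireg t)(12 := n + bR n pr r),
        rreg := (rreg t)(3 := W (i + l + 1), 4 := W (i + r), 7 := N, 8 := f)\<rparr>"
      unfolding s1_def N_def f_def
      by (rule sem_scan_load)
        (use I w(3) reg m4 in \<open>simp_all add: t_def base_def scan_inv_def l_def r_def\<close>)
    have s9: "ireg s 9 = i" "ireg s 3 = 1" using I w(3) by (auto simp: scan_inv_def base_def)
    have 1: "ireg s' = (ireg s)(0 := (if N \<le> rreg s 6 then v else ireg s 0), 9 := Suc i, 10 := v,
        12 := n + bR n pr r)"
      "imem s' = imem s" "rmem s' = rmem s"
      "rreg s' = (rreg s)(3 := W (i + l + 1), 4 := W (i + r),
         6 := (if N \<le> rreg s 6 then N else rreg s 6), 7 := N, 8 := f)"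
      using s9 by (simp_all add: s' s1 t_def fun_upd_twist fun_eq_iff)
    have "base s'" using w(3) unfolding base_def 1 by simp
    then have "gaps_from s' 0" using gaps_from_cong[OF w(1)] 1 by simp
    moreover have "best_inv (Suc i) s'"
    proof (cases "N \<le> rreg s 6")
      case T: True
      have "N \<le> new_load n w pr x" if "x < i" "pr x = 0" for x
        using T I that unfolding scan_inv_def best_inv_def by fastforce
      then show ?thesis using True T unfolding best_inv_def 1 by (auto simp: less_Suc_eq N_def v_def)
    next
      case F: False
      \<comment> \<open>A rejected candidate shows that the minimum is below its starting value,
        hence attained by an earlier candidate.\<close>
      have "N \<le> W (2 * n)" using new_load_le_total[OF i True] by (simp add: N_def)
      then have "\<not> (rreg s 6 = W (2 * n))" using F by auto
      then obtain x where "x < i" "pr x = 0" "ireg s 0 = c (int x)" "rreg s 6 = new_load n w pr x"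
        using I unfolding scan_inv_def best_inv_def by auto
      moreover have "\<forall>x < i. pr x = 0 \<longrightarrow> rreg s 6 \<le> new_load n w pr x"
        using I unfolding scan_inv_def best_inv_def by auto
      ultimately show ?thesis using F unfolding best_inv_def 1 by (auto simp: less_Suc_eq N_def)
    qed
    moreover have "gap_inv l s'" using I i0 unfolding scan_inv_def gap_inv_def 1 by (simp flip: l_def)
    ultimately show ?thesis using I unfolding scan_inv_def by (simp add: 1 pl)
  qed
qed (simp_all add: scan_body_def scan_cand_def scan_load_def scan_site_def macro_defs)

lemma scan_loop: "ht (scan_inv 0) (While 1 9 scan_body) (n * 82 + 1) (scan_inv n)"
proof -
  have "ireg s 1 \<le> ireg s 9 \<longleftrightarrow> i = n" if "i \<le> n" "scan_inv i s" for i s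
    using that by (auto simp: scan_inv_def gaps_from_def walked_def prios_def base_def)
  from ht_while[where I = scan_inv, OF scan_step this] show ?thesis by simp
qed

lemma p_le_n: "p \<le> n"
  using card_mono[of "verts G" "set S"] S verts by (simp add: p distinct_card)

lemma scan_result:
  assumes "scan_inv n s" "verts G - set S \<noteq> {}"
  shows "balanced_vertex G \<pi> S (ireg s 0)"
proof -
  have free: "\<exists>x < n. pr x = 0 \<and> u = c (int x)" if "u \<in> verts G - set S" for u
    using that cyc_enum_verts[OF c] prio_pos_iff[of S u] by (auto simp: pr_def)
  have best: "best_inv n s" using assms by (simp add: scan_inv_def)
  obtain x where x: "x < n" "pr x = 0" "ireg s 0 = c (int x)" "rreg s 6 = new_load n w pr x"
  proof -
    obtain u where "u \<in> verts G - set S" using assms(2) by auto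
    then obtain x where "x < n" "pr x = 0" using free by blast
    then have "\<not> (\<forall>x < n. 0 < pr x)" by auto
    then show thesis using that best unfolding best_inv_def by blast
  qed
  have "c (int x) \<in> verts G - set S"
    using x cyc_enum_verts[OF c] prio_pos_iff[of S "c (int x)"] by (auto simp: pr_def)
  moreover have "new_load n w pr x \<le> new_load n w pr y" if "y < n" "pr y = 0" for y
    using best that x unfolding best_inv_def by auto
  moreover have "new_load n w pr x \<le> max_load G \<pi> (S @ [u])" if "u \<in> verts G - set S" for u
    using free[OF that] calculation(2) max_load_new by auto
  ultimately show ?thesis unfolding balanced_vertex_def x(3) max_load_new[OF x(1,2)] by blast
qed

text \<open>The loops cost 8, 24, 42 and 82 steps per round, with \<open>p \<le> n\<close> rounds in
  the first; the remaining 33 steps are rounded up to 40.\<close>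

lemma bv_main_correct:
  assumes "verts G - set S \<noteq> {}"
  shows "ht (mark_inv 0) bv_main (156 * n + 40) (\<lambda>s. balanced_vertex G \<pi> S (ireg s 0))"
  unfolding bv_main_def
  by (rule ht_weaken[OF ht_seq[OF mark_loop ht_seq[OF walk_init ht_seq[OF walk_loop ht_seq[OF back_init
        ht_seq[OF back_loop ht_seq[OF scan_init scan_loop]]]]]]])
    (use scan_result assms p_le_n in auto)

end


subsection \<open>Input encoding and running time\<close>

text \<open>The test catches an empty list, for which register 0 still holds vertex 0.\<close>

definition bv_program :: com where
  "bv_program = prelude ;; IfI 2 15 Skip bv_main"

text \<open>The memory behind the input is 0, which is the priority table of the empty list, so it
  needs no initialization.\<close>

lemma (in bv_cycle) sem_prelude:
  assumes "M 0 = n" "M 1 = p" "imem s = M" "ireg s = (\<lambda>_. 0)"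
    and "\<And>v. v < n \<Longrightarrow> M (A + v) = 0" "\<And>v. v < n \<Longrightarrow> rmem s v = \<pi> v"
  shows "mark_inv 0 (sem prelude s)"
proof -
  define t where "t = sem prelude s"
  have "ireg t 1 = n" "ireg t 2 = p" "ireg t 3 = 1" "ireg t 4 = A" "ireg t 5 = A + n"
    "ireg t 6 = A + n + n + 1" "ireg t 7 = A + n + n + n + 2" "ireg t 8 = p + 2"
    "ireg t 14 = n + n + n + 1" "ireg t 15 = 0" "ireg t 9 = 0"
    using assms(1-4) by (simp_all add: t_def prelude_def A)
  moreover have "imem t = M" "rmem t = rmem s"
    using assms(1-4) by (simp_all add: t_def prelude_def)
  ultimately show ?thesis
    using assms(5,6) unfolding t_def[symmetric] mark_inv_def base_def by (simp add: prio_def)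
qed

lemma prelude_params:
  assumes "imem s 0 = n" "imem s 1 = p" "ireg s = (\<lambda>_. 0)"
  shows "ireg (sem prelude s) 2 = p" "ireg (sem prelude s) 15 = 0" "ireg (sem prelude s) 0 = 0"
  using assms by (simp_all add: prelude_def)

text \<open>Independence of \<open>v\<close> makes every vertex optimal when \<open>S\<close> is
  empty.\<close>

lemma max_load_single:
  assumes "v \<in> verts G" shows "max_load G \<pi> [v] = sum \<pi> (verts G)"
proof -
  have "territory G [v] 0 = verts G"
    by (auto simp: territory_def gdist_list_def)
  then show ?thesis by (simp add: max_load_def load_def lessThan_Suc)
qed

text \<open>Degree 2 everywhere gives records of length 3, so their addresses are computed by
  additions alone.\<close>

lemma concat_blocks:
  assumes "\<forall>ws \<in> set adj. length ws = 2"
  shows "length (concat (map (\<lambda>ws. length ws # ws) adj)) = 3 * length adj"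
    and "v < length adj \<Longrightarrow> j < 3 \<Longrightarrow>
      concat (map (\<lambda>ws. length ws # ws) adj) ! (3 * v + j) = (2 # adj ! v) ! j"
proof -
  show "length (concat (map (\<lambda>ws. length ws # ws) adj)) = 3 * length adj"
    using assms by (induction adj) auto
  show "concat (map (\<lambda>ws. length ws # ws) adj) ! (3 * v + j) = (2 # adj ! v) ! j"
    if "v < length adj" "j < 3"
    using assms that
  proof (induction adj arbitrary: v)
    case (Cons ws adj)
    show ?case
    proof (cases v)
      case 0
      then show ?thesis using Cons.prems by (simp add: nth_append nth_Cons split: nat.split)
    next
      case (Suc u)
      have "concat (map (\<lambda>ws. length ws # ws) (ws # adj)) ! (3 * v + j) =
          concat (map (\<lambda>ws. length ws # ws) adj) ! (3 * u + j)"
        using Cons.prems Suc by (simp add: nth_append)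
      then show ?thesis using Cons Suc by simp
    qed
  qed simp
qed

lemma encode_input_nth:
  assumes "\<forall>ws \<in> set adj. length ws = 2"
  shows "length (encode_input adj S) = 2 + length S + 3 * length adj"
    and "encode_input adj S ! 0 = length adj" "encode_input adj S ! 1 = length S"
    and "k < length S \<Longrightarrow> encode_input adj S ! (2 + k) = S ! k"
    and "v < length adj \<Longrightarrow> encode_input adj S ! (length S + 2 + v + v + v + 1) = adj ! v ! 0"
    and "v < length adj \<Longrightarrow> encode_input adj S ! (length S + 2 + v + v + v + 1 + 1) = adj ! v ! 1"
proof -
  note b = concat_blocks[OF assms]
  have e: "encode_input adj S ! (length S + 2 + j) = concat (map (\<lambda>ws. length ws # ws) adj) ! j" for j
    by (simp add: encode_input_def nth_append)
  show "length (encode_input adj S) = 2 + length S + 3 * length adj"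
    by (simp only: encode_input_def length_append b(1)) simp
  show "encode_input adj S ! 0 = length adj" "encode_input adj S ! 1 = length S"
    by (simp_all add: encode_input_def)
  show "encode_input adj S ! (2 + k) = S ! k" if "k < length S"
    using that by (simp add: encode_input_def nth_append)
  have j: "length S + 2 + v + v + v + 1 = length S + 2 + (3 * v + 1)"
    "length S + 2 + v + v + v + 1 + 1 = length S + 2 + (3 * v + 2)" by auto
  show "encode_input adj S ! (length S + 2 + v + v + v + 1) = adj ! v ! 0"
    if "v < length adj" unfolding j(1) e using b(2)[OF that, of 1] by simp
  show "encode_input adj S ! (length S + 2 + v + v + v + 1 + 1) = adj ! v ! 1"
    if "v < length adj" unfolding j(2) e using b(2)[OF that, of 2] by simp
qed

text \<open>Because \<open>3 \<le> n\<close>, the two neighbours differ and the list has exactly two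
  entries. Their order is unknown, but their sum is not.\<close>

lemma adjacency_cycle:
  assumes c: "cyc_enum G n c" and adj: "adjacency_lists G adj" and v: "c i < length adj"
  obtains x y where "adj ! c i = [x, y]" "{x, y} = {c (i - 1), c (i + 1)}" "x + y = c (i - 1) + c (i + 1)"
proof -
  have ne: "c (i - 1) \<noteq> c (i + 1)"
  proof
    assume "c (i - 1) = c (i + 1)"
    then have "(i + 1) mod int n = (i - 1) mod int n" using c unfolding cyc_enum_def by metis
    then have "int n dvd 2" by (simp add: mod_eq_dvd_iff)
    then show False using zdvd_imp_le[of "int n" 2] c by (simp add: cyc_enum_def)
  qed
  have s: "distinct (adj ! c i)" "set (adj ! c i) = {c (i - 1), c (i + 1)}"
    using adj v cyc_enum_neighbours[OF c] by (auto simp: adjacency_lists_def)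
  then have "length (adj ! c i) = 2" using ne distinct_card by fastforce
  then obtain x y where xy: "adj ! c i = [x, y]" by (auto simp: numeral_2_eq_2 length_Suc_conv)
  then have "{x, y} = {c (i - 1), c (i + 1)}" using s by simp
  then show thesis using that xy by (auto simp: doubleton_eq_iff)
qed

text \<open>A rotation brings \<open>s\<close> to index 0; if \<open>t\<close> then lies at index 1,
  a reflection follows. This matches the enumeration to the direction of the walk.\<close>

lemma cyc_enum_oriented:
  assumes "cyc_enum G n c" "s \<in> verts G" "{s, t} \<in> edges G"
  obtains c' where "cyc_enum G n c'" "c' 0 = s" "c' (- 1) = t"
proof -
  obtain k where k: "s = c k" using assms(1,2) by (auto simp: cyc_enum_def)
  then have "t \<in> {c (k - 1), c (k + 1)}" using cyc_enum_neighbours[OF assms(1)] assms(3) by blast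
  then consider "t = c (k - 1)" | "t = c (k + 1)" by auto
  then show thesis
  proof cases
    case 1
    then show ?thesis using that[OF cyc_enum_shift[OF assms(1), of k]] k by simp
  next
    case 2
    then show ?thesis
      using that[OF cyc_enum_reflect[OF cyc_enum_shift[OF assms(1), of k]]] k
      by (simp add: add.commute)
  qed
qed

theorem lemma3p4:
  "\<exists>(P :: instr list) (T :: nat \<Rightarrow> nat).
     (\<lambda>n. real (T n)) \<in> O(\<lambda>n. real n) \<and> solves_balanced_vertex P is_cycle T"
proof (intro exI conjI)
  show "(\<lambda>n. real (156 * n + 56)) \<in> O(\<lambda>n. real n)"
    \<comment> \<open>212 = 156 + 56 works from \<open>n = 1\<close> on.\<close>
    by (rule bigoI[of _ 212]) (auto intro!: eventually_at_top_linorderI[of 1])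
  show "solves_balanced_vertex (compile bv_program 0) is_cycle (\<lambda>n. 156 * n + 56)"
    unfolding solves_balanced_vertex_def Let_def
  proof (intro allI impI, elim conjE)
    fix G \<pi> S adj n
    assume cyc: "is_cycle G" and n: "card (verts G) = n" and inst: "balanced_vertex_instance G \<pi> S"
      and adj: "adjacency_lists G adj"
    define s0 where "s0 = init_state (encode_input adj S) (map \<pi> [0..<n])"
    obtain d where d: "cyc_enum G n d" using is_cycle_enum[OF cyc] n by auto
    have la: "length adj = n" and V: "verts G = {..<n}" using adj n by (auto simp: adjacency_lists_def)
    have n3: "3 \<le> n" using d by (simp add: cyc_enum_def)
    have free: "verts G - set S \<noteq> {}" and nonneg: "\<And>v. v < n \<Longrightarrow> 0 \<le> \<pi> v"
      and S: "distinct S" "set S \<subseteq> verts G"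
      using inst V by (auto simp: balanced_vertex_instance_def proper_vertex_list_def)
    have "length (adj ! v) = 2" if v: "v < length adj" for v
    proof -
      have "v \<in> verts G" using v V la by simp
      then obtain i where "v = d i" using d by (auto simp: cyc_enum_def)
      then show ?thesis using adjacency_cycle[OF d adj, of i] v by (metis length_Cons list.size(3) numeral_2_eq_2)
    qed
    then have "\<forall>ws \<in> set adj. length ws = 2" by (auto simp: in_set_conv_nth)
    note enc = encode_input_nth[OF this, where S = S]
    define M where "M = imem s0"
    have M: "M a = encode_input adj S ! a" if "a < 2 + length S + 3 * n" for a
      using that enc(1) by (simp add: M_def s0_def init_state_def la)
    have M0: "M a = 0" if "2 + length S + 3 * n \<le> a" for a
      using that enc(1) by (simp add: M_def s0_def init_state_def la)
    have s0: "ireg s0 = (\<lambda>_. 0)" "pc s0 = 0" and rm: "v < n \<Longrightarrow> rmem s0 v = \<pi> v" for v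
      by (simp_all add: s0_def init_state_def)
    have params: "M 0 = n" "M 1 = length S" using M[of 0] M[of 1] enc(2,3) la by auto
    note pre = prelude_params[OF params[unfolded M_def] s0(1)]
    \<comment> \<open>14 instructions of the prelude and 2 steps for the branch complete the
      constant 56.\<close>
    have "ht (\<lambda>s. s = s0) bv_program (14 + (156 * n + 40 + 2)) (\<lambda>s. balanced_vertex G \<pi> S (ireg s 0))"
    proof (cases "S = []")
      case True
      have "balanced_vertex G \<pi> S 0"
        using True V n3 max_load_single[of _ G \<pi>] by (simp add: balanced_vertex_def)
      moreover have "ireg (sem prelude s0) 2 \<le> ireg (sem prelude s0) 15" "ireg (sem prelude s0) 0 = 0"
        using pre True by auto
      ultimately have "ht (\<lambda>s. s = sem prelude s0) (IfI 2 15 Skip bv_main) (156 * n + 40 + 2)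
         (\<lambda>s. balanced_vertex G \<pi> S (ireg s 0))"
        by (intro ht_IfI ht_sem ht_absurd) auto
      then show ?thesis unfolding bv_program_def
        by (intro ht_seq) (auto intro!: ht_sem simp: prelude_def)
    next
      case False
      have "S ! 0 \<in> set S" using False by simp
      then have S0: "S ! 0 < n" "S ! 0 \<in> verts G" using S V by auto
      from S0(2) obtain i where i: "S ! 0 = d i" using d by (auto simp: cyc_enum_def)
      obtain x y where "adj ! (S ! 0) = [x, y]" "{x, y} = {d (i - 1), d (i + 1)}"
        using adjacency_cycle[OF d adj, of i] i S0 la by metis
      then have xy: "adj ! (S ! 0) ! 1 = y" "{S ! 0, y} \<in> edges G"
        using cyc_enum_neighbours[OF d, of i] i by auto
      obtain c where c: "cyc_enum G n c" "c 0 = S ! 0" "c (- 1) = y"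
        using cyc_enum_oriented[OF d S0(2) xy(2)] by auto
      have cn: "c i < n" for i using c(1) V by (auto simp: cyc_enum_def)
      interpret bv_cycle G \<pi> S n c M "length S" "2 + length S + 3 * n"
      proof
        show "M (2 + k) = S ! k" if "k < length S" for k using M[of "2 + k"] enc(4) that by simp
        show "M (length S + 2 + c i + c i + c i + 1) + M (length S + 2 + c i + c i + c i + 1 + 1) =
            c (i - 1) + c (i + 1)" for i
        proof -
          obtain x y where "adj ! c i = [x, y]" "x + y = c (i - 1) + c (i + 1)"
            using adjacency_cycle[OF c(1) adj, of i] cn la by metis
          then show ?thesis
            using M[of "length S + 2 + c i + c i + c i + 1"] enc(5)[of "c i"]
              M[of "length S + 2 + c i + c i + c i + 1 + 1"] enc(6)[of "c i"] cn[of i] la by simp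
        qed
        show "M (length S + 2 + c 0 + c 0 + c 0 + 1 + 1) = c (- 1)"
          using M[of "length S + 2 + c 0 + c 0 + c 0 + 1 + 1"] enc(6)[of "c 0"] cn[of 0] la c xy by simp
      qed (use c S V nonneg False in auto)
      have "mark_inv 0 (sem prelude s0)"
        using params s0 rm M0 by (intro sem_prelude) (auto simp: M_def)
      with pre have "ht (\<lambda>s. s = sem prelude s0) (IfI 2 15 Skip bv_main) (156 * n + 40 + 2)
         (\<lambda>s. balanced_vertex G \<pi> S (ireg s 0))"
        using False by (intro ht_IfI) (auto intro: ht_absurd ht_weaken[OF bv_main_correct[OF free]])
      then show ?thesis unfolding bv_program_def
        by (intro ht_seq) (auto intro!: ht_sem simp: prelude_def)
    qed
    then show "halted (compile bv_program 0) (ram_run (compile bv_program 0) (156 * n + 56)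
          (init_state (encode_input adj S) (map \<pi> [0..<n]))) \<and>
        balanced_vertex G \<pi> S (ireg (ram_run (compile bv_program 0) (156 * n + 56)
          (init_state (encode_input adj S) (map \<pi> [0..<n]))) 0)"
      unfolding s0_def[symmetric] by (rule ht_run) (use s0 in auto)
  qed
qed

end
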